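(* Each of $t$-Robust 2-Club, $t$-Hereditary 2-Club, and $t$-Connected 2-Club on an input graph with $n$ vertices and maximum degree $\Delta$ can be solved by solving $O(n)$ instances of $t$-Robust 2-Club, $t$-Hereditary 2-Club, and $t$-Connected 2-Club, respectively, where each of these instances contains at most $\Delta^{2}$ vertices.
   Context: All graphs are simple and undirected. For a graph $G=(V,E)$ and $S\subseteq V$, $G[S]$ is the induced subgraph; $S$ is a 2-club if $G[S]$ has diameter at most two. $S$ is a $t$-robust 2-club if every pair of vertices of $S$ is connected in $G[S]$ by $t$ internally vertex-disjoint paths of length at most two. $S$ is a $t$-hereditary 2-club if $G[S\setminus U]$ is a 2-club for every $U\subset S$ with $|U|\le t$. $S$ is a $t$-connected 2-club if it is a 2-club, $|S|>t$, and $G[S\setminus U]$ is connected for all $U\subseteq S$ with $|U|<t$. The problems $t$-Robust / $t$-Hereditary / $t$-Connected 2-Club take as input an undirected graph $G$ and nonnegative integers $t$ and $k$ and ask whether $G$ contains a $t$-robust / $t$-hereditary / $t$-connected 2-club of size at least $k$. *)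

theory Defs
  imports
    "Graph_Theory.Graph_Theory"
    "HOL-Library.Landau_Symbols"
    "HOL-Library.Log_Nat"
    "HOL-Computational_Algebra.Polynomial"
begin

section \<open>Well-connected 2-clubs\<close>

text \<open>
  A simple undirected graph is a \<^locale>\<open>pair_graph\<close>: a finite, loop-free, symmetric arc relation.
\<close>

text \<open>
  Supremum of the unweighted distances; the value is infinite for disconnected graphs, and the
  empty graph has diameter at most two.
\<close>
definition diameter :: "('a, 'b) pre_digraph \<Rightarrow> ereal" where
  "diameter G = (SUP u\<in>verts G. SUP v\<in>verts G. wf_digraph.\<mu> G (\<lambda>_. 1) u v)"

definition two_club :: "'a pair_pre_digraph \<Rightarrow> 'a set \<Rightarrow> bool" where
  "two_club G S \<longleftrightarrow> S \<subseteq> pverts G \<and> diameter (with_proj G \<restriction> S) \<le> 2"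

definition internal_verts :: "'a vwalk \<Rightarrow> 'a set" where
  "internal_verts p = set (butlast (tl p))"

text \<open>For \<open>t = 0\<close> the condition is void, so every vertex set is a 0-robust 2-club.\<close>
definition robust_two_club :: "nat \<Rightarrow> 'a pair_pre_digraph \<Rightarrow> 'a set \<Rightarrow> bool" where
  "robust_two_club t G S \<longleftrightarrow> S \<subseteq> pverts G \<and>
     (\<forall>u\<in>S. \<forall>v\<in>S. u \<noteq> v \<longrightarrow>
        (\<exists>P. finite P \<and> card P = t \<and>
           (\<forall>p\<in>P. vpath p (with_proj G \<restriction> S) \<and> hd p = u \<and> last p = v \<and> vwalk_length p \<le> 2) \<and>
           (\<forall>p\<in>P. \<forall>q\<in>P. p \<noteq> q \<longrightarrow> internal_verts p \<inter> internal_verts q = {})))"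

definition hereditary_two_club :: "nat \<Rightarrow> 'a pair_pre_digraph \<Rightarrow> 'a set \<Rightarrow> bool" where
  "hereditary_two_club t G S \<longleftrightarrow> S \<subseteq> pverts G \<and>
     (\<forall>U. U \<subset> S \<and> card U \<le> t \<longrightarrow> two_club G (S - U))"

definition connected_two_club :: "nat \<Rightarrow> 'a pair_pre_digraph \<Rightarrow> 'a set \<Rightarrow> bool" where
  "connected_two_club t G S \<longleftrightarrow> two_club G S \<and> card S > t \<and>
     (\<forall>U. U \<subseteq> S \<and> card U < t \<longrightarrow> Digraph_Component.connected (with_proj G \<restriction> (S - U)))"

text \<open>The maximum over the empty vertex set is taken to be 0.\<close>
definition max_degree :: "'a pair_pre_digraph \<Rightarrow> nat" where
  "max_degree G = Max (insert 0 (out_degree (with_proj G) ` pverts G))"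


section \<open>The decision problems\<close>

text \<open>Instances are triples \<open>(G, t, k)\<close>, where \<open>G\<close> is a graph on the vertices \<open>{..<n}\<close>.\<close>
type_synonym club_inst = "nat pair_pre_digraph \<times> nat \<times> nat"

definition robust_problem :: "club_inst \<Rightarrow> bool" where
  "robust_problem = (\<lambda>(G, t, k). \<exists>S. robust_two_club t G S \<and> k \<le> card S)"

definition hereditary_problem :: "club_inst \<Rightarrow> bool" where
  "hereditary_problem = (\<lambda>(G, t, k). \<exists>S. hereditary_two_club t G S \<and> k \<le> card S)"

definition connected_problem :: "club_inst \<Rightarrow> bool" where
  "connected_problem = (\<lambda>(G, t, k). \<exists>S. connected_two_club t G S \<and> k \<le> card S)"

text \<open>Number of bits of an instance: an adjacency matrix and two numbers in binary.\<close>
definition inst_size :: "club_inst \<Rightarrow> nat" where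
  "inst_size = (\<lambda>(G, t, k). card (pverts G) ^ 2 + floorlog 2 t + floorlog 2 k)"


section \<open>Oracle algorithms\<close>

text \<open>
  Algorithms are programs of a random access machine whose memory consists of two-dimensional
  arrays of natural numbers. The only arithmetic is addition and truncated subtraction, so under
  the unit-cost measure the numbers occurring in \<open>T\<close> steps have \<open>O(T)\<close> bits more than
  those of the input, and polynomial time has its usual meaning. In particular multiplication,
  with which unit cost would be too generous, is not primitive.
\<close>

type_synonym memory = "string \<Rightarrow> nat \<Rightarrow> nat \<Rightarrow> nat"

datatype exp =
    Const nat
  | Cell string exp exp
  | Plus exp exp
  | Minus exp exp

fun val :: "memory \<Rightarrow> exp \<Rightarrow> nat" where
  "val m (Const c) = c"
| "val m (Cell x e f) = m x (val m e) (val m f)"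
| "val m (Plus e f) = val m e + val m f"
| "val m (Minus e f) = val m e - val m f"

text \<open>
  \<open>Assign x e f g\<close> performs \<open>x[e, f] := g\<close>; conditions are true when nonzero.
  \<open>Query y x e f g\<close> submits to the oracle the instance with \<open>e\<close> vertices, adjacency matrix
  \<open>x\<close> and parameters \<open>f\<close>, \<open>g\<close>, and stores the answer in \<open>y[0, 0]\<close>.
\<close>
datatype com =
    Skip
  | Assign string exp exp exp
  | Seq com com
  | If exp com com
  | While exp com
  | Query string string exp exp exp

definition store :: "memory \<Rightarrow> string \<Rightarrow> nat \<Rightarrow> nat \<Rightarrow> nat \<Rightarrow> memory" where
  "store m x i j c = m(x := (m x)(i := (m x i)(j := c)))"

text \<open>Symmetrized and with the diagonal ignored, so that every query is about a simple graph.\<close>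
definition graph_of_matrix :: "nat \<Rightarrow> (nat \<Rightarrow> nat \<Rightarrow> nat) \<Rightarrow> nat pair_pre_digraph" where
  "graph_of_matrix n a = \<lparr> pverts = {..<n},
     parcs = {(u, v). u < n \<and> v < n \<and> u \<noteq> v \<and> (a u v \<noteq> 0 \<or> a v u \<noteq> 0)} \<rparr>"

lemma pair_graph_graph_of_matrix: "pair_graph (graph_of_matrix n a)"
proof
  have "parcs (graph_of_matrix n a) \<subseteq> {..<n} \<times> {..<n}"
    by (auto simp: graph_of_matrix_def)
  then show "finite (parcs (graph_of_matrix n a))"
    by (rule finite_subset) simp
qed (auto simp: graph_of_matrix_def symmetric_def sym_def)

definition query_inst :: "memory \<Rightarrow> string \<Rightarrow> exp \<Rightarrow> exp \<Rightarrow> exp \<Rightarrow> club_inst" where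
  "query_inst m x e f g = (graph_of_matrix (val m e) (m x), val m f, val m g)"

text \<open>
  \<open>exec P c m T qs m'\<close>: with an oracle for \<open>P\<close>, the program \<open>c\<close> started in memory \<open>m\<close>
  terminates in memory \<open>m'\<close> after time \<open>T\<close>, having submitted the instances \<open>qs\<close> to the oracle.
  A query costs the size of the submitted instance.
\<close>
inductive exec :: "(club_inst \<Rightarrow> bool) \<Rightarrow> com \<Rightarrow> memory \<Rightarrow> nat \<Rightarrow> club_inst list \<Rightarrow> memory \<Rightarrow> bool"
  for P where
  Skip: "exec P Skip m 1 [] m"
| Assign: "exec P (Assign x e f g) m 1 [] (store m x (val m e) (val m f) (val m g))"
| Seq: "exec P c m T qs m' \<Longrightarrow> exec P d m' T' qs' m'' \<Longrightarrow>
    exec P (Seq c d) m (1 + T + T') (qs @ qs') m''"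
| IfTrue: "val m e \<noteq> 0 \<Longrightarrow> exec P c m T qs m' \<Longrightarrow> exec P (If e c d) m (1 + T) qs m'"
| IfFalse: "val m e = 0 \<Longrightarrow> exec P d m T qs m' \<Longrightarrow> exec P (If e c d) m (1 + T) qs m'"
| WhileFalse: "val m e = 0 \<Longrightarrow> exec P (While e c) m 1 [] m"
| WhileTrue: "val m e \<noteq> 0 \<Longrightarrow> exec P c m T qs m' \<Longrightarrow> exec P (While e c) m' T' qs' m'' \<Longrightarrow>
    exec P (While e c) m (1 + T + T') (qs @ qs') m''"
| Query: "q = query_inst m x e f g \<Longrightarrow>
    exec P (Query y x e f g) m (1 + inst_size q) [q] (store m y 0 0 (of_bool (P q)))"

inductive_cases exec_SkipE: "exec P Skip m T qs m'"
inductive_cases exec_AssignE: "exec P (Assign x e f g) m T qs m'"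
inductive_cases exec_SeqE: "exec P (Seq c d) m T qs m'"
inductive_cases exec_IfE: "exec P (If e c d) m T qs m'"
inductive_cases exec_WhileE: "exec P (While e c) m T qs m'"
inductive_cases exec_QueryE: "exec P (Query y x e f g) m T qs m'"

lemma exec_deterministic:
  assumes "exec P c m T qs m1" and "exec P c m T' qs' m2"
  shows "T = T' \<and> qs = qs' \<and> m1 = m2"
  using assms
proof (induction arbitrary: T' qs' m2 rule: exec.induct)
  case (Skip m)
  then show ?case by (elim exec_SkipE) simp
next
  case (Assign x e f g m)
  then show ?case by (elim exec_AssignE) simp
next
  case (Seq c m T qs m' d U rs m'')
  show ?case
    by (rule exec_SeqE[OF Seq.prems]) (auto dest!: Seq.IH)
next
  case (IfTrue m e c T qs m' d)
  show ?case
    by (rule exec_IfE[OF IfTrue.prems]) (use IfTrue.hyps in \<open>auto dest!: IfTrue.IH\<close>)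
next
  case (IfFalse m e d T qs m' c)
  show ?case
    by (rule exec_IfE[OF IfFalse.prems]) (use IfFalse.hyps in \<open>auto dest!: IfFalse.IH\<close>)
next
  case (WhileFalse m e c)
  show ?case
    by (rule exec_WhileE[OF WhileFalse.prems]) (use WhileFalse.hyps in simp_all)
next
  case (WhileTrue m e c T qs m' U rs m'')
  show ?case
    by (rule exec_WhileE[OF WhileTrue.prems]) (use WhileTrue.hyps in \<open>auto dest!: WhileTrue.IH\<close>)
next
  case (Query q m x e f g y)
  then show ?case by (elim exec_QueryE) simp
qed

definition input_memory :: "club_inst \<Rightarrow> memory" where
  "input_memory = (\<lambda>(G, t, k) x i j.
     if x = ''adj'' then of_bool ((i, j) \<in> parcs G)
     else if (i, j) \<noteq> (0, 0) then 0
     else if x = ''n'' then card (pverts G)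
     else if x = ''t'' then t
     else if x = ''k'' then k
     else 0)"

definition accepting :: "memory \<Rightarrow> bool" where
  "accepting m \<longleftrightarrow> m ''out'' 0 0 \<noteq> 0"

end

theory Submission
  imports Defs
begin

text \<open>
  A 2-club containing a vertex \<open>v\<close> lies in the ball \<open>B\<close> of radius two around \<open>v\<close>, which has at most
  \<open>D\<^sup>2 + 1\<close> vertices, where \<open>D\<close> is the maximum degree. If \<open>B\<close> has at most \<open>D\<^sup>2\<close> vertices, query it.
  Otherwise, if two vertices \<open>a\<close>, \<open>b\<close> of \<open>B\<close> have distance more than two in the whole graph, no
  2-club contains both, and it suffices to query \<open>B - {a}\<close> and \<open>B - {b}\<close>. In the remaining case
  every vertex of \<open>B\<close> has all of \<open>B\<close> as its ball, so counting paths of length at most two shows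
  that \<open>B\<close> is a component which is a Moore graph: it is \<open>D\<close>-regular and any two of its vertices are
  joined by exactly one such path. There the answer is explicit. For robustness or heredity at
  least 2 resp. 1, unique paths leave only sets of size at most 1 resp. 2; and the whole graph is
  \<open>D\<close>-connected, while no solution is more than \<open>D\<close>-connected.
\<close>

section \<open>Adjacency characterizations\<close>

text \<open>The bound D^2 + 1 counts the centre, at most D neighbours and at most D (D - 1) vertices
  beyond them, while a query may have only D^2 vertices; this excess of one vertex shapes the whole
  argument. All three properties of a set S depend only on the graph induced on S, so a solution
  inside any queried set is a solution of the whole graph, and only completeness needs care. In a
  Moore graph (a single vertex, a single edge, the 5-cycle, the Petersen graph) the best solution
  may be the entire graph, which no query of D^2 vertices contains; hence the answer without an
  oracle. The empty set and the 0-robust sets that are not 2-clubs escape a search through the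
  balls, so they are decided before it. Verdicts are combined by "or" alone, with at most two
  queries for each vertex.\<close>

definition near :: "('a \<Rightarrow> 'a \<Rightarrow> bool) \<Rightarrow> 'a set \<Rightarrow> 'a \<Rightarrow> 'a \<Rightarrow> bool" where
  "near E S u v \<longleftrightarrow> u = v \<or> E u v \<or> (\<exists>w\<in>S. E u w \<and> E w v)"

definition club :: "('a \<Rightarrow> 'a \<Rightarrow> bool) \<Rightarrow> 'a set \<Rightarrow> bool" where
  "club E S \<longleftrightarrow> (\<forall>u\<in>S. \<forall>v\<in>S. near E S u v)"

definition short_paths :: "('a \<Rightarrow> 'a \<Rightarrow> bool) \<Rightarrow> 'a set \<Rightarrow> 'a \<Rightarrow> 'a \<Rightarrow> nat" where
  "short_paths E S u v = of_bool (E u v) + card {w\<in>S. E u w \<and> E w v}"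

definition robust :: "nat \<Rightarrow> ('a \<Rightarrow> 'a \<Rightarrow> bool) \<Rightarrow> 'a set \<Rightarrow> bool" where
  "robust t E S \<longleftrightarrow> (\<forall>u\<in>S. \<forall>v\<in>S. u \<noteq> v \<longrightarrow> t \<le> short_paths E S u v)"

definition hereditary :: "nat \<Rightarrow> ('a \<Rightarrow> 'a \<Rightarrow> bool) \<Rightarrow> 'a set \<Rightarrow> bool" where
  "hereditary t E S \<longleftrightarrow> (\<forall>U. U \<subset> S \<and> card U \<le> t \<longrightarrow> club E (S - U))"

text \<open>Connectedness in terms of cuts, which transfers easily along injections.\<close>
definition crossed :: "('a \<Rightarrow> 'a \<Rightarrow> bool) \<Rightarrow> 'a set \<Rightarrow> bool" where
  "crossed E S \<longleftrightarrow> (\<forall>A. A \<subset> S \<and> A \<noteq> {} \<longrightarrow> (\<exists>a\<in>A. \<exists>b\<in>S - A. E a b))"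

definition conn :: "nat \<Rightarrow> ('a \<Rightarrow> 'a \<Rightarrow> bool) \<Rightarrow> 'a set \<Rightarrow> bool" where
  "conn t E S \<longleftrightarrow> club E S \<and> t < card S \<and> (\<forall>U. U \<subseteq> S \<and> card U < t \<longrightarrow> crossed E (S - U))"

abbreviation adj :: "'a pair_pre_digraph \<Rightarrow> 'a \<Rightarrow> 'a \<Rightarrow> bool" where
  "adj G u v \<equiv> (u, v) \<in> parcs G"

section \<open>From walks, paths and components of the digraph library to adjacency\<close>

lemma wf_digraph_induce: "wf_digraph (with_proj G \<restriction> S)"
  by unfold_locales (auto simp: induce_subgraph_def)

text \<open>With unit costs the cost of a walk is its length. Lengths are integers, so if no walk
  has length at most 2, all costs and hence their infimum are at least 3; without any walk the
  infimum is infinite.\<close>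

lemma mu_le_two_iff:
  assumes "wf_digraph H"
  shows "wf_digraph.\<mu> H (\<lambda>_. 1) u v \<le> 2 \<longleftrightarrow> (\<exists>p. pre_digraph.awalk H u p v \<and> length p \<le> 2)"
proof -
  interpret wf_digraph H by fact
  have cost: "awalk_cost (\<lambda>_. 1) p = length p" for p
    by (induction p) auto
  show ?thesis
  proof
    assume l: "\<mu> (\<lambda>_. 1) u v \<le> 2"
    show "\<exists>p. awalk u p v \<and> length p \<le> 2"
    proof (rule ccontr)
      assume "\<not> ?thesis"
      then have "3 \<le> length p" if "awalk u p v" for p
        using that by (auto simp: not_le Suc_le_eq)
      then have "(3::ereal) \<le> \<mu> (\<lambda>_. 1) u v"
        unfolding \<mu>_def cost by (intro INF_greatest) auto
      then have "(3::ereal) \<le> 2"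
        using l by (rule order_trans)
      then show False by simp
    qed
  next
    assume "\<exists>p. awalk u p v \<and> length p \<le> 2"
    then obtain p where "awalk u p v" "length p \<le> 2" by blast
    then have "\<mu> (\<lambda>_. 1) u v \<le> ereal (length p)" "ereal (length p) \<le> 2"
      using min_cost_le_walk_cost[of u p v "\<lambda>_. 1"] by (auto simp: cost)
    then show "\<mu> (\<lambda>_. 1) u v \<le> 2" by (rule order_trans)
  qed
qed

lemma short_awalk_iff_near:
  assumes "u \<in> S" "v \<in> S"
  shows "(\<exists>p. pre_digraph.awalk (with_proj G \<restriction> S) u p v \<and> length p \<le> 2) \<longleftrightarrow> near (adj G) S u v"
proof -
  interpret wf_digraph "with_proj G \<restriction> S" by (rule wf_digraph_induce)
  \<comment> \<open>\<open>remdups_adj.cases\<close> splits lists into the empty list, singletons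
    and lists with at least two elements.\<close>
  have two: "length p \<le> 2 \<longleftrightarrow> p = [] \<or> (\<exists>e. p = [e]) \<or> (\<exists>e f. p = [e, f])"
    for p :: "('a \<times> 'a) list"
    by (cases p rule: remdups_adj.cases) auto
  have sel: "verts (with_proj G \<restriction> S) = S" "tail (with_proj G \<restriction> S) = fst"
      "head (with_proj G \<restriction> S) = snd"
      "arcs (with_proj G \<restriction> S) = {e \<in> parcs G. fst e \<in> S \<and> snd e \<in> S}"
    by (auto simp: induce_subgraph_def)
  have "(\<exists>p. awalk u p v \<and> length p \<le> 2) \<longleftrightarrow>
      awalk u [] v \<or> (\<exists>e. awalk u [e] v) \<or> (\<exists>e f. awalk u [e, f] v)"
    unfolding two by blast
  also have "\<dots> \<longleftrightarrow> near (adj G) S u v"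
    using assms by (auto simp: near_def awalk_Cons_iff awalk_Nil_iff sel)
  finally show ?thesis .
qed

lemma two_club_iff: "two_club G S \<longleftrightarrow> S \<subseteq> pverts G \<and> club (adj G) S"
  unfolding two_club_def diameter_def club_def SUP_le_iff mu_le_two_iff[OF wf_digraph_induce]
  by (simp add: induce_subgraph_verts short_awalk_iff_near cong: ball_cong)

lemma hereditary_two_club_iff:
  "hereditary_two_club t G S \<longleftrightarrow> S \<subseteq> pverts G \<and> hereditary t (adj G) S"
  unfolding hereditary_two_club_def hereditary_def two_club_iff by blast

text \<open>\<open>connected\<close> demands a nonempty vertex set whereas \<open>crossed\<close>
  holds for the empty one, hence the assumption on \<open>S\<close>. The arc relation is symmetric,
  so the symmetric closure adds nothing and connectedness is reachability inside
  \<open>S\<close>.\<close>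

lemma connected_induce_iff:
  assumes "pair_graph G" "S \<noteq> {}"
  shows "Digraph_Component.connected (with_proj G \<restriction> S) \<longleftrightarrow> crossed (adj G) S"
proof -
  interpret G: pair_graph G by fact
  have sym: "(v, u) \<in> parcs G" if "(u, v) \<in> parcs G" for u v
    using G.sym_arcs that by (auto simp: symmetric_def sym_def)
  define r where "r = {(u, v). (u, v) \<in> parcs G \<and> u \<in> S \<and> v \<in> S}"
  have arcs: "parcs (mk_symmetric (with_proj G \<restriction> S)) = r"
    by (auto simp: mk_symmetric_def induce_subgraph_def r_def dest: sym)
  have "Digraph_Component.connected (with_proj G \<restriction> S) \<longleftrightarrow>
      (\<forall>u\<in>S. \<forall>v\<in>S. (u, v) \<in> rtrancl_on S r)"
    using assms(2)
    by (auto simp: connected_def strongly_connected_def reachable_def arcs)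
  also have "\<dots> \<longleftrightarrow> crossed (adj G) S"
  proof
    assume reach: "\<forall>u\<in>S. \<forall>v\<in>S. (u, v) \<in> rtrancl_on S r"
    show "crossed (adj G) S"
      unfolding crossed_def
    proof (intro allI impI, elim conjE)
      fix A assume A: "A \<subset> S" "A \<noteq> {}"
      then obtain a b where "a \<in> A" "b \<in> S - A" by blast
      show "\<exists>a\<in>A. \<exists>b\<in>S - A. (a, b) \<in> parcs G"
      proof (rule ccontr)
        assume *: "\<not> ?thesis"
        have "(a, b) \<in> rtrancl_on S r" using reach A \<open>a \<in> A\<close> \<open>b \<in> S - A\<close> by blast
        then have "b \<in> A"
          by (rule rtrancl_on_induct) (use * \<open>a \<in> A\<close> in \<open>auto simp: r_def\<close>)
        with \<open>b \<in> S - A\<close> show False by simp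
      qed
    qed
  next
    assume cr: "crossed (adj G) S"
    show "\<forall>u\<in>S. \<forall>v\<in>S. (u, v) \<in> rtrancl_on S r"
    proof (intro ballI)
      fix u v assume uv: "u \<in> S" "v \<in> S"
      \<comment> \<open>No arc of the induced graph leaves the set of vertices reachable from
        \<open>u\<close>, so \<open>crossed\<close> forces it to be all of \<open>S\<close>.\<close>
      define A where "A = {x. (u, x) \<in> rtrancl_on S r}"
      have "A \<subseteq> S" "u \<in> A" using uv by (auto simp: A_def dest: in_rtrancl_on_in_F)
      have "\<not> (\<exists>a\<in>A. \<exists>b\<in>S - A. (a, b) \<in> parcs G)"
        using \<open>A \<subseteq> S\<close> by (auto simp: A_def r_def intro: rtrancl_on_into_rtrancl_on)
      then have "A = S" using cr \<open>A \<subseteq> S\<close> \<open>u \<in> A\<close> unfolding crossed_def by blast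
      then show "(u, v) \<in> rtrancl_on S r" using uv by (auto simp: A_def)
    qed
  qed
  finally show ?thesis .
qed

lemma connected_two_club_iff:
  assumes "pair_graph G"
  shows "connected_two_club t G S \<longleftrightarrow> S \<subseteq> pverts G \<and> conn t (adj G) S"
proof -
  \<comment> \<open>Fewer than \<open>t\<close> vertices are removed from more than
    \<open>t\<close>, so some vertex remains and \<open>connected_induce_iff\<close>
    applies.\<close>
  have "Digraph_Component.connected (with_proj G \<restriction> (S - U)) \<longleftrightarrow> crossed (adj G) (S - U)"
    if "t < card S" "U \<subseteq> S" "card U < t" for U
    using that by (intro connected_induce_iff[OF assms]) auto
  then show ?thesis
    by (auto simp: connected_two_club_def conn_def two_club_iff)
qed

text \<open>When the candidates are pairwise compatible anyway, a choice of \<open>t\<close>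
  compatible ones is a matter of counting. The candidates will be the short paths between two
  vertices, and \<open>R\<close> their internal disjointness.\<close>

lemma ex_card_subset_iff:
  assumes "finite X" "\<And>p. Q p \<longleftrightarrow> p \<in> X" "\<And>p q. p \<in> X \<Longrightarrow> q \<in> X \<Longrightarrow> p \<noteq> q \<Longrightarrow> R p q"
  shows "(\<exists>P. finite P \<and> card P = t \<and> (\<forall>p\<in>P. Q p) \<and> (\<forall>p\<in>P. \<forall>q\<in>P. p \<noteq> q \<longrightarrow> R p q)) \<longleftrightarrow>
    t \<le> card X"
proof
  assume "t \<le> card X"
  then obtain P where "P \<subseteq> X" "card P = t" "finite P"
    by (rule obtain_subset_with_card_n)
  then show "\<exists>P. finite P \<and> card P = t \<and> (\<forall>p\<in>P. Q p) \<and> (\<forall>p\<in>P. \<forall>q\<in>P. p \<noteq> q \<longrightarrow> R p q)"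
    using assms(2,3) by (intro exI[of _ P]) blast
next
  assume "\<exists>P. finite P \<and> card P = t \<and> (\<forall>p\<in>P. Q p) \<and> (\<forall>p\<in>P. \<forall>q\<in>P. p \<noteq> q \<longrightarrow> R p q)"
  then obtain P where "card P = t" "P \<subseteq> X"
    using assms(2) by blast
  then show "t \<le> card X"
    using card_mono[OF assms(1)] by blast
qed

text \<open>A path of length at most two between distinct vertices is the edge or is determined by
  its midpoint. Distinct paths of this kind are internally disjoint, so Menger-like selection
  reduces to the count \<open>short_paths\<close>.\<close>

lemma robust_two_club_iff:
  assumes "pair_graph G"
  shows "robust_two_club t G S \<longleftrightarrow> S \<subseteq> pverts G \<and> robust t (adj G) S"
proof -
  interpret G: pair_graph G by fact
  have no_loop: "(x, x) \<notin> parcs G" for x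
    using G.pair_no_loops[of "(x, x)"] by auto
  have path: "vpath p (with_proj G \<restriction> S) \<and> hd p = u \<and> last p = v \<and> vwalk_length p \<le> 2 \<longleftrightarrow>
      p \<in> {p. p = [u, v] \<and> (u, v) \<in> parcs G} \<union>
          (\<lambda>w. [u, w, v]) ` {w\<in>S. (u, w) \<in> parcs G \<and> (w, v) \<in> parcs G}"
    (is "_ \<longleftrightarrow> p \<in> ?X u v")
    if uv: "u \<in> S" "v \<in> S" "u \<noteq> v" for p u v
  proof -
    have three: "length p \<le> 3 \<longleftrightarrow> p = [] \<or> (\<exists>a. p = [a]) \<or> (\<exists>a b. p = [a, b]) \<or> (\<exists>a b c. p = [a, b, c])"
      by (cases p rule: remdups_adj.cases) (auto simp: length_Suc_conv le_Suc_eq)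
    have "vwalk_length p \<le> 2 \<longleftrightarrow> length p \<le> 3" by auto
    then show ?thesis
      unfolding three using uv
      by (auto simp: vpath_def vwalk_def arcs_ends_conv induce_subgraph_def image_iff no_loop)
  qed
  have "(\<exists>P. finite P \<and> card P = t \<and>
           (\<forall>p\<in>P. vpath p (with_proj G \<restriction> S) \<and> hd p = u \<and> last p = v \<and> vwalk_length p \<le> 2) \<and>
           (\<forall>p\<in>P. \<forall>q\<in>P. p \<noteq> q \<longrightarrow> internal_verts p \<inter> internal_verts q = {})) \<longleftrightarrow>
        t \<le> short_paths (adj G) S u v"
    (is "?L \<longleftrightarrow> ?R") if uv: "u \<in> S" "v \<in> S" "u \<noteq> v" "S \<subseteq> pverts G" for u v
  proof -
    have fin: "finite S" using uv(4) G.pair_finite_verts by (rule finite_subset)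
    have finX: "finite (?X u v)" using fin by auto
    have card: "card (?X u v) = short_paths (adj G) S u v"
      using fin by (subst card_Un_disjoint) (auto simp: short_paths_def card_image inj_on_def)
    have disj: "internal_verts p \<inter> internal_verts q = {}"
      if "p \<in> ?X u v" "q \<in> ?X u v" "p \<noteq> q" for p q
      using that by (auto simp: internal_verts_def)
    show ?thesis
      unfolding card[symmetric] by (rule ex_card_subset_iff[OF finX path[OF uv(1-3)] disj])
  qed
  then show ?thesis
    unfolding robust_two_club_def robust_def by (intro conj_cong refl ball_cong imp_cong) auto
qed

lemma max_degree_eq:
  "max_degree G = Max (insert 0 ((\<lambda>v. card {u. (v, u) \<in> parcs G}) ` pverts G))"
proof -
  have "out_degree (with_proj G) v = card {u. (v, u) \<in> parcs G}" for v
  proof -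
    have "out_arcs (with_proj G) v = Pair v ` {u. (v, u) \<in> parcs G}"
      by (auto simp: out_arcs_def image_iff)
    then show ?thesis
      by (simp add: out_degree_def card_image inj_on_def)
  qed
  then show ?thesis by (simp add: max_degree_def)
qed

section \<open>Balls of radius two and Moore graphs\<close>

locale bounded_graph =
  fixes V :: "'a set" and E :: "'a \<Rightarrow> 'a \<Rightarrow> bool" and D :: nat
  assumes finite_V: "finite V"
    and edge_in_V: "E u v \<Longrightarrow> u \<in> V \<and> v \<in> V"
    and edge_sym: "E u v \<Longrightarrow> E v u"
    and edge_irrefl: "\<not> E u u"
    and degree_le: "v \<in> V \<Longrightarrow> card {u. E v u} \<le> D"
begin

lemma finite_nbrs: "finite {u. E v u}"
  by (rule finite_subset[OF _ finite_V]) (auto dest: edge_in_V)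

definition ball :: "'a \<Rightarrow> 'a set" where
  "ball x = {y\<in>V. near E V x y}"

lemma ball_subset: "ball x \<subseteq> V"
  by (auto simp: ball_def)

lemma finite_ball: "finite (ball x)"
  using ball_subset finite_V by (rule finite_subset)

lemma club_subset_ball: "club E S \<Longrightarrow> S \<subseteq> V \<Longrightarrow> x \<in> S \<Longrightarrow> S \<subseteq> ball x"
  by (fastforce simp: club_def ball_def near_def)

lemma short_paths_mono: "S \<subseteq> V \<Longrightarrow> short_paths E S u v \<le> short_paths E V u v"
  unfolding short_paths_def by (intro add_left_mono card_mono) (auto simp: finite_V)

lemma near_iff_short_paths: "finite S \<Longrightarrow> near E S u v \<longleftrightarrow> u = v \<or> 0 < short_paths E S u v"
  by (auto simp: near_def short_paths_def card_gt_0_iff)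

text \<open>Double counting: each neighbour \<open>w\<close> of \<open>x\<close> accounts for the
  path that ends in \<open>w\<close> and for at most D - 1 paths through \<open>w\<close>, because
  going back to \<open>x\<close> is excluded.\<close>

lemma sum_short_paths_le:
  assumes "x \<in> V"
  shows "(\<Sum>y\<in>V - {x}. short_paths E V x y) \<le> card {u. E x u} * D"
proof -
  let ?N = "{u. E x u}"
  have N: "{y \<in> V - {x}. E x y} = ?N"
    by (auto dest: edge_in_V simp: edge_irrefl)
  have card_common: "card {w\<in>V. E x w \<and> E w y} = (\<Sum>w\<in>?N. of_bool (E w y))" for y
  proof -
    have "{w\<in>V. E x w \<and> E w y} = ?N \<inter> {w. E w y}"
      by (auto dest: edge_in_V)
    then show ?thesis by (simp add: finite_nbrs)
  qed
  have inner: "(\<Sum>y\<in>V - {x}. of_bool (E w y)) \<le> D - 1" if "w \<in> ?N" for w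
  proof -
    have "(\<Sum>y\<in>V - {x}. of_bool (E w y)) = card {y\<in>V - {x}. E w y}"
      by (simp add: finite_V Int_def)
    also have "{y\<in>V - {x}. E w y} = {y. E w y} - {x}"
      by (auto dest: edge_in_V)
    also have "card \<dots> = card {y. E w y} - 1"
      using that by (simp add: finite_nbrs edge_sym)
    also have "\<dots> \<le> D - 1"
      using that by (intro diff_le_mono degree_le) (auto dest: edge_in_V)
    finally show ?thesis .
  qed
  have "(\<Sum>y\<in>V - {x}. short_paths E V x y)
      = card {y \<in> V - {x}. E x y} + (\<Sum>w\<in>?N. \<Sum>y\<in>V - {x}. of_bool (E w y))"
    unfolding short_paths_def sum.distrib card_common
    by (subst sum.swap) (simp add: finite_V Int_def)
  also have "\<dots> \<le> card ?N + card ?N * (D - 1)"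
    unfolding N using sum_bounded_above[of ?N, OF inner] by simp
  \<comment> \<open>For D = 0 the truncated D - 1 is harmless, as \<open>x\<close> then has no
    neighbours.\<close>
  also have "\<dots> = card ?N * D"
    using degree_le[OF assms] by (cases D) auto
  finally show ?thesis .
qed

lemma sum_short_paths_ball: "(\<Sum>y\<in>ball x - {x}. short_paths E V x y) \<le> (\<Sum>y\<in>V - {x}. short_paths E V x y)"
  by (rule sum_mono2) (auto simp: finite_V ball_def)

lemma card_ball_minus: "x \<in> V \<Longrightarrow> card (ball x) = Suc (card (ball x - {x}))"
  by (intro card.remove finite_ball) (auto simp: ball_def near_def)

lemma short_paths_ball_pos: "y \<in> ball x - {x} \<Longrightarrow> 1 \<le> short_paths E V x y"
  using near_iff_short_paths[OF finite_V, of x y] by (auto simp: ball_def)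

lemma card_ball_minus_le: "card (ball x - {x}) \<le> (\<Sum>y\<in>ball x - {x}. short_paths E V x y)"
  using sum_mono[of "ball x - {x}" "\<lambda>_. 1" "short_paths E V x"] short_paths_ball_pos by simp

text \<open>The Moore bound for diameter two: every vertex of the ball other than \<open>x\<close>
  uses up at least one of the at most D^2 short paths from \<open>x\<close>.\<close>

lemma card_ball_le:
  assumes "x \<in> V"
  shows "card (ball x) \<le> D\<^sup>2 + 1"
proof -
  have "card (ball x - {x}) \<le> (\<Sum>y\<in>ball x - {x}. short_paths E V x y)"
    by (rule card_ball_minus_le)
  also have "\<dots> \<le> D * D"
    using sum_short_paths_ball sum_short_paths_le[OF assms] mult_le_mono1[OF degree_le[OF assms]]
    by (meson order_trans)
  finally show ?thesis using card_ball_minus[OF assms] by (simp add: power2_eq_square)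
qed

text \<open>Equality in the Moore bound makes every estimate of its proof tight. A missing neighbour
  would make the number of short paths too small, and a vertex reached by two short paths would
  waste one.\<close>

lemma extremal_ball:
  assumes "x \<in> V" "card (ball x) = D\<^sup>2 + 1"
  shows "card {u. E x u} = D" "y \<in> V \<Longrightarrow> y \<noteq> x \<Longrightarrow> short_paths E V x y \<le> 1"
proof -
  have card: "card (ball x - {x}) = D * D"
    using assms card_ball_minus by (simp add: power2_eq_square)
  have le: "(\<Sum>y\<in>ball x - {x}. short_paths E V x y) \<le> card {u. E x u} * D"
    using sum_short_paths_ball sum_short_paths_le[OF assms(1)] by (rule order_trans)
  have "D * D \<le> (\<Sum>y\<in>ball x - {x}. short_paths E V x y)"
    using card_ball_minus_le[of x] card by simp
  then have "D * D \<le> card {u. E x u} * D"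
    using le by linarith
  then show deg: "card {u. E x u} = D"
    using degree_le[OF assms(1)] by (cases "D = 0") auto
  show "short_paths E V x y \<le> 1" if y: "y \<in> V" "y \<noteq> x"
  proof (rule ccontr)
    assume gt: "\<not> ?thesis"
    then have "y \<in> ball x - {x}"
      using y near_iff_short_paths[OF finite_V, of x y] by (auto simp: ball_def)
    then have "(\<Sum>y\<in>ball x - {x}. 1) < (\<Sum>y\<in>ball x - {x}. short_paths E V x y)"
      using gt short_paths_ball_pos
      by (intro sum_strict_mono_ex1 bexI[of _ y]) (auto simp: finite_ball)
    then show False using card le deg by simp
  qed
qed

end

text \<open>The graph induced by \<open>ball c\<close> is then a Moore graph and a connected component.\<close>
locale moore_ball = bounded_graph +
  fixes c :: 'a
  assumes c_in_V: "c \<in> V"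
    and card_N: "card (ball c) = D\<^sup>2 + 1"
    and N_near: "x \<in> ball c \<Longrightarrow> y \<in> ball c \<Longrightarrow> near E V x y"
begin

abbreviation "N \<equiv> ball c"

lemma c_in_N: "c \<in> N"
  using c_in_V by (simp add: ball_def near_def)

lemma N_in_V: "x \<in> N \<Longrightarrow> x \<in> V"
  using ball_subset by blast

text \<open>The ball of \<open>x\<close> contains \<open>N\<close>, and the Moore bound leaves it no
  room for a further vertex. Hence every vertex of \<open>N\<close> is the centre of an extremal
  ball.\<close>

lemma ball_eq_N:
  assumes "x \<in> N"
  shows "ball x = N"
proof -
  have "N \<subseteq> ball x"
    using N_near[OF assms] by (auto simp: ball_def)
  moreover have "card (ball x) \<le> card N"
    using card_ball_le[of x] card_N N_in_V[OF assms] by simp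
  ultimately show ?thesis
    using card_seteq[OF finite_ball] by blast
qed

lemma N_closed: "x \<in> N \<Longrightarrow> E x y \<Longrightarrow> y \<in> N"
  using ball_eq_N[of x] edge_in_V[of x y] by (auto simp: ball_def near_def)

lemma degree_eq: "x \<in> N \<Longrightarrow> card {u. E x u} = D"
  using extremal_ball(1)[of x] ball_eq_N[of x] card_N N_in_V[of x] by simp

lemma short_paths_le_1: "x \<in> N \<Longrightarrow> y \<in> V \<Longrightarrow> y \<noteq> x \<Longrightarrow> short_paths E V x y \<le> 1"
  using extremal_ball(2)[of x] ball_eq_N[of x] card_N N_in_V[of x] by simp

text \<open>The edge and the path through \<open>z\<close> would be two short paths between
  \<open>x\<close> and \<open>y\<close>. Together with \<open>no_square\<close> this says that
  cycles in \<open>N\<close> have length at least five.\<close>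

lemma no_triangle:
  assumes "x \<in> N" "E x y" "E x z" "E z y"
  shows False
proof -
  have "y \<noteq> x" using assms(2) edge_irrefl by metis
  then have "short_paths E V x y \<le> 1"
    using assms edge_in_V by (intro short_paths_le_1) auto
  moreover have "card {w\<in>V. E x w \<and> E w y} > 0"
    using assms finite_V by (auto simp: card_gt_0_iff dest: edge_in_V)
  ultimately show False using assms(2) by (simp add: short_paths_def)
qed

lemma no_square:
  assumes "x \<in> N" "y \<noteq> x" "E x z" "E z y" "E x z'" "E z' y"
  shows "z = z'"
proof -
  have "short_paths E V x y \<le> 1"
    using assms edge_in_V by (intro short_paths_le_1) auto
  then have "card {w\<in>V. E x w \<and> E w y} \<le> Suc 0" by (simp add: short_paths_def)
  then show ?thesis
    using assms finite_V by (subst (asm) card_le_Suc0_iff_eq) (auto dest: edge_in_V)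
qed

lemma near_N: "x \<in> N \<Longrightarrow> y \<in> N \<Longrightarrow> near E N x y"
  using N_near[of x y] N_closed by (auto simp: near_def)

lemma club_N: "club E N"
  using near_N by (auto simp: club_def)

lemma robust_N: "robust 1 E N"
  using near_N near_iff_short_paths[OF finite_ball]
  by (auto simp: robust_def Suc_le_eq)

lemma robust_moore:
  assumes "robust t E S" "S \<subseteq> N" "2 \<le> t"
  shows "card S \<le> 1"
proof (rule ccontr)
  assume "\<not> ?thesis"
  then obtain u v where uv: "u \<in> S" "v \<in> S" "u \<noteq> v"
    using card_le_Suc0_iff_eq[of S] finite_subset[OF assms(2) finite_ball] by auto
  then have "t \<le> short_paths E S u v" using assms(1) by (simp add: robust_def)
  also have "\<dots> \<le> short_paths E V u v"
    using assms(2) ball_subset by (intro short_paths_mono) blast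
  also have "\<dots> \<le> 1" using uv assms(2) N_in_V by (intro short_paths_le_1) auto
  finally show False using assms(3) by simp
qed

text \<open>Two nonadjacent vertices of \<open>S\<close> have a common neighbour in
  \<open>S\<close>; after its deletion they need a second one, which closes a 4-cycle. So
  \<open>S\<close> is a clique, and without triangles it has at most two vertices.\<close>

lemma hereditary_moore:
  assumes her: "hereditary t E S" and S: "S \<subseteq> N" and t: "1 \<le> t"
  shows "card S \<le> 2"
proof -
  have finS: "finite S" using S finite_ball by (rule finite_subset)
  have clique: "E u v" if uv: "u \<in> S" "v \<in> S" "u \<noteq> v" for u v
  proof (rule ccontr)
    assume nE: "\<not> E u v"
    have "{} \<subset> S" using uv by auto
    then have "club E (S - {})" using her unfolding hereditary_def by (metis card.empty le0)
    then obtain w where w: "w \<in> S" "E u w" "E w v"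
      using uv nE by (auto simp: club_def near_def)
    then have "u \<noteq> w" "v \<noteq> w" using edge_irrefl by metis+
    have "{w} \<subset> S" "card {w} \<le> t" using w uv \<open>u \<noteq> w\<close> t by auto
    then have "club E (S - {w})" using her unfolding hereditary_def by blast
    then obtain w' where "w' \<noteq> w" "E u w'" "E w' v"
      using uv nE \<open>u \<noteq> w\<close> \<open>v \<noteq> w\<close> by (auto simp: club_def near_def)
    then show False using no_square[of u v w w'] w uv S by auto
  qed
  show ?thesis
  proof (rule ccontr)
    assume "\<not> ?thesis"
    then have "3 \<le> card S" by simp
    then obtain T where "T \<subseteq> S" "card T = 3" by (metis obtain_subset_with_card_n)
    then obtain a b d where "a \<in> S" "b \<in> S" "d \<in> S" "a \<noteq> b" "a \<noteq> d" "b \<noteq> d"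
      by (auto simp: card_3_iff)
    then show False
      using no_triangle[of a b d] clique S by blast
  qed
qed

text \<open>
  The \<open>D\<close> neighbours of \<open>a\<close> start \<open>D\<close> internally disjoint paths to \<open>b\<close>, each of which has to
  meet a set separating \<open>a\<close> from \<open>b\<close>.
\<close>
lemma crossed_moore:
  assumes U: "U \<subseteq> N" "card U < D"
  shows "crossed E (N - U)"
  unfolding crossed_def
proof (intro allI impI, rule ccontr, elim conjE)
  fix A assume A: "A \<subset> N - U" "A \<noteq> {}"
    and nocross: "\<not> (\<exists>a\<in>A. \<exists>b\<in>N - U - A. E a b)"
  then obtain a b where ab: "a \<in> A" "b \<in> N - U - A" by blast
  have aN: "a \<in> N" "a \<notin> U" and bN: "b \<in> N" "b \<notin> U" using A ab by auto
  \<comment> \<open>\<open>y\<close> is the point where the path from \<open>a\<close> through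
    \<open>z\<close> to \<open>b\<close> meets \<open>U\<close>. If \<open>z\<close> is outside
    \<open>U\<close> it is still on the side \<open>A\<close>, hence not adjacent to
    \<open>b\<close>, and the middle vertex between \<open>z\<close> and \<open>b\<close> must be in
    \<open>U\<close> since no edge crosses.\<close>
  have "\<exists>y. y \<in> U \<and> (y = z \<or> z \<notin> U \<and> E z y \<and> E y b)" if z: "E a z" for z
  proof (cases "z \<in> U")
    case False
    have zN: "z \<in> N" using N_closed[OF aN(1) z] .
    with False z ab nocross have "z \<in> A" by blast
    then have "\<not> E z b" "z \<noteq> b" using ab nocross by auto
    then obtain y where y: "y \<in> N" "E z y" "E y b"
      using near_N[OF zN bN(1)] by (auto simp: near_def)
    then have "y \<in> U" using nocross \<open>z \<in> A\<close> ab by blast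
    then show ?thesis using y False by blast
  qed auto
  then obtain g where g: "\<And>z. E a z \<Longrightarrow> g z \<in> U \<and> (g z = z \<or> z \<notin> U \<and> E z (g z) \<and> E (g z) b)"
    by metis
  have "inj_on g {z. E a z}"
  proof (rule inj_onI, clarsimp)
    fix z z' assume z: "E a z" "E a z'" "g z = g z'"
    have ne: "a \<noteq> g z" using g[OF z(1)] aN by auto
    \<comment> \<open>Two paths may meet \<open>U\<close> in the same vertex in four ways: both at
      their first step, which is the claim; one at its first and the other at its second step, a
      triangle with \<open>a\<close>; or both at the second step, a 4-cycle through
      \<open>a\<close>.\<close>
    consider "g z = z" "g z' = z'" | "E z' z" | "E z z'" | "E z (g z)" "E z' (g z)"
      using g[OF z(1)] g[OF z(2)] z(3) by metis
    then show "z = z'"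
      using z no_triangle[of a z z'] no_triangle[of a z' z] no_square[of a "g z" z z'] aN ne
      by cases auto
  qed
  then have "card {z. E a z} \<le> card U"
    using g U finite_subset[OF U(1) finite_ball] by (intro card_inj_on_le[of g]) auto
  then show False using degree_eq aN U by simp
qed

lemma conn_N:
  assumes "t \<le> D"
  shows "conn t E N"
proof -
  \<comment> \<open>This secures the requirement that a \<open>t\<close>-connected set has more than
    \<open>t\<close> vertices.\<close>
  have "D \<le> D\<^sup>2" by (cases D) (auto simp: power2_eq_square)
  then have "t < card N" using assms card_N by linarith
  moreover have "crossed E (N - U)" if "U \<subseteq> N" "card U < t" for U
    using that assms by (intro crossed_moore) auto
  ultimately show ?thesis
    unfolding conn_def using club_N by blast
qed

end

text \<open>The neighbours of a vertex \<open>a\<close> in \<open>S\<close> are at most D vertices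
  whose removal isolates \<open>a\<close>. If D < t < card S, the removal is admissible and leaves a
  vertex besides \<open>a\<close>, so the rest is disconnected.\<close>

lemma (in bounded_graph) conn_le_degree:
  assumes "conn t E S" "S \<subseteq> V"
  shows "t \<le> D"
proof (rule ccontr)
  assume "\<not> ?thesis"
  have "finite S" using assms finite_V finite_subset by blast
  have "t < card S" using assms by (simp add: conn_def)
  then obtain a where a: "a \<in> S" by fastforce
  define U where "U = {u. E a u} \<inter> S"
  have "card U \<le> card {u. E a u}"
    unfolding U_def by (intro card_mono finite_nbrs) auto
  also have "\<dots> \<le> D" using a assms by (intro degree_le) auto
  finally have cU: "card U \<le> D" .
  then have cr: "crossed E (S - U)"
    using assms \<open>\<not> t \<le> D\<close> by (auto simp: conn_def U_def)
  have "a \<in> S - U" using a edge_irrefl by (simp add: U_def)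
  moreover have "{a} \<noteq> S - U"
  proof
    assume "{a} = S - U"
    then have "card (S - U) = 1" by (metis card_1_singleton_iff One_nat_def)
    then have "card S = card U + 1"
      using card_Diff_subset[of U S] card_mono[of S U] \<open>finite S\<close>
      by (simp add: U_def finite_nbrs)
    then show False using cU \<open>\<not> t \<le> D\<close> \<open>t < card S\<close> by simp
  qed
  ultimately have "{a} \<subset> S - U" by blast
  then obtain b where "b \<in> S - U - {a}" "E a b"
    using cr[unfolded crossed_def, rule_format, of "{a}"] by auto
  then show False by (auto simp: U_def)
qed

section \<open>Invariance under the relabelling that turns a set of vertices into an oracle
  instance\<close>

lemma near_image:
  assumes "inj_on L S" "\<And>i j. i \<in> S \<Longrightarrow> j \<in> S \<Longrightarrow> E' i j \<longleftrightarrow> E (L i) (L j)" "i \<in> S" "j \<in> S"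
  shows "near E (L ` S) (L i) (L j) \<longleftrightarrow> near E' S i j"
  using assms by (auto simp: near_def inj_on_eq_iff)

lemma club_image:
  assumes "inj_on L S" "\<And>i j. i \<in> S \<Longrightarrow> j \<in> S \<Longrightarrow> E' i j \<longleftrightarrow> E (L i) (L j)"
  shows "club E (L ` S) \<longleftrightarrow> club E' S"
  using near_image[of L S E' E, OF assms] by (simp add: club_def)

lemma short_paths_image:
  assumes "inj_on L S" "\<And>i j. i \<in> S \<Longrightarrow> j \<in> S \<Longrightarrow> E' i j \<longleftrightarrow> E (L i) (L j)" "i \<in> S" "j \<in> S"
  shows "short_paths E (L ` S) (L i) (L j) = short_paths E' S i j"
proof -
  have "{w \<in> L ` S. E (L i) w \<and> E w (L j)} = L ` {w\<in>S. E' i w \<and> E' w j}"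
    using assms by auto
  moreover have "inj_on L {w\<in>S. E' i w \<and> E' w j}"
    using assms(1) by (rule inj_on_subset) auto
  ultimately show ?thesis
    using assms by (simp add: short_paths_def card_image)
qed

lemma robust_image:
  assumes "inj_on L S" "\<And>i j. i \<in> S \<Longrightarrow> j \<in> S \<Longrightarrow> E' i j \<longleftrightarrow> E (L i) (L j)"
  shows "robust t E (L ` S) \<longleftrightarrow> robust t E' S"
  using short_paths_image[of L S E' E, OF assms] by (simp add: robust_def inj_on_eq_iff[OF assms(1)])

lemma all_image_subset_iff:
  "(\<forall>U. U \<subseteq> L ` S \<longrightarrow> F U) \<longleftrightarrow> (\<forall>U. U \<subseteq> S \<longrightarrow> F (L ` U))"
  by (metis subset_image_iff)

lemma crossed_image:
  assumes "inj_on L S" "\<And>i j. i \<in> S \<Longrightarrow> j \<in> S \<Longrightarrow> E' i j \<longleftrightarrow> E (L i) (L j)"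
  shows "crossed E (L ` S) \<longleftrightarrow> crossed E' S"
proof -
  have "L ` A = L ` S \<longleftrightarrow> A = S" "(\<exists>a\<in>L ` A. \<exists>b\<in>L ` S - L ` A. E a b) \<longleftrightarrow> (\<exists>a\<in>A. \<exists>b\<in>S - A. E' a b)"
    if A: "A \<subseteq> S" for A
  proof -
    show "L ` A = L ` S \<longleftrightarrow> A = S"
      using inj_on_image_eq_iff[OF assms(1) A] by auto
    have "L ` S - L ` A = L ` (S - A)"
      using inj_on_image_set_diff[OF assms(1), of S A] A by auto
    moreover have "E (L a) (L b) \<longleftrightarrow> E' a b" if "a \<in> A" "b \<in> S" for a b
      using that A assms(2) by auto
    ultimately show "(\<exists>a\<in>L ` A. \<exists>b\<in>L ` S - L ` A. E a b) \<longleftrightarrow> (\<exists>a\<in>A. \<exists>b\<in>S - A. E' a b)"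
      by auto
  qed
  \<comment> \<open>Proper inclusion is split into inclusion and inequality so that
    \<open>all_image_subset_iff\<close> can pull the quantified subset back to
    \<open>S\<close>.\<close>
  then show ?thesis
    unfolding crossed_def psubset_eq conj_assoc imp_conjL all_image_subset_iff
    by (simp cong: imp_cong)
qed

lemma inj_on_image_minus:
  assumes "inj_on L S" "U \<subseteq> S"
  shows "L ` S - L ` U = L ` (S - U)" "card (L ` U) = card U" "inj_on L (S - U)"
    "L ` U = L ` S \<longleftrightarrow> U = S"
  using assms inj_on_image_set_diff[OF assms(1), of S U] inj_on_image_eq_iff[OF assms(1), of U S]
  by (auto intro: card_image inj_on_subset)

lemma hereditary_image:
  assumes "inj_on L S" "\<And>i j. i \<in> S \<Longrightarrow> j \<in> S \<Longrightarrow> E' i j \<longleftrightarrow> E (L i) (L j)"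
  shows "hereditary t E (L ` S) \<longleftrightarrow> hereditary t E' S"
proof -
  have "club E (L ` (S - U)) \<longleftrightarrow> club E' (S - U)" if "U \<subseteq> S" for U
    using that assms by (intro club_image) (auto intro: inj_on_subset)
  then show ?thesis
    unfolding hereditary_def psubset_eq conj_assoc imp_conjL all_image_subset_iff
    by (simp add: inj_on_image_minus[OF assms(1)] cong: imp_cong)
qed

lemma conn_image:
  assumes "inj_on L S" "\<And>i j. i \<in> S \<Longrightarrow> j \<in> S \<Longrightarrow> E' i j \<longleftrightarrow> E (L i) (L j)"
  shows "conn t E (L ` S) \<longleftrightarrow> conn t E' S"
proof -
  have "crossed E (L ` (S - U)) \<longleftrightarrow> crossed E' (S - U)" if "U \<subseteq> S" for U
    using that assms by (intro crossed_image) (auto intro: inj_on_subset)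
  then show ?thesis
    unfolding conn_def imp_conjL all_image_subset_iff
    by (simp add: inj_on_image_minus[OF assms(1)] club_image[of L S E' E, OF assms] card_image[OF assms(1)]
        cong: imp_cong)
qed

section \<open>Running times of programs\<close>

text \<open>Total correctness with a time bound. The postcondition also sees the submitted queries,
  so their number and size can be carried through the program. Existence of one execution is enough
  because \<open>exec\<close> is deterministic.\<close>

definition runs ::
  "(club_inst \<Rightarrow> bool) \<Rightarrow> com \<Rightarrow> memory \<Rightarrow> nat \<Rightarrow> (club_inst list \<Rightarrow> memory \<Rightarrow> bool) \<Rightarrow> bool" where
  "runs P c m B R \<longleftrightarrow> (\<exists>T qs m'. exec P c m T qs m' \<and> T \<le> B \<and> R qs m')"

lemma runs_mono:
  assumes "runs P c m B R" "B \<le> B'" "\<And>qs m'. R qs m' \<Longrightarrow> R' qs m'"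
  shows "runs P c m B' R'"
  using assms unfolding runs_def by (meson order_trans)

lemma runs_assign:
  "runs P (Assign x e f g) m 1 (\<lambda>qs m'. qs = [] \<and> m' = store m x (val m e) (val m f) (val m g))"
  unfolding runs_def using exec.Assign by blast

lemma runs_skip: "runs P Skip m 1 (\<lambda>qs m'. qs = [] \<and> m' = m)"
  unfolding runs_def using exec.Skip by blast

lemma runs_query:
  "runs P (Query y x e f g) m (1 + inst_size (query_inst m x e f g))
    (\<lambda>qs m'. qs = [query_inst m x e f g] \<and> m' = store m y 0 0 (of_bool (P (query_inst m x e f g))))"
  unfolding runs_def using exec.Query by blast

lemma runs_seq:
  assumes "runs P c m B1 Q" "\<And>qs m'. Q qs m' \<Longrightarrow> runs P d m' B2 (\<lambda>qs'. R (qs @ qs'))"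
  shows "runs P (Seq c d) m (1 + B1 + B2) R"
proof -
  obtain T qs m' where 1: "exec P c m T qs m'" "T \<le> B1" "Q qs m'"
    using assms(1) by (auto simp: runs_def)
  then obtain T' qs' m'' where "exec P d m' T' qs' m''" "T' \<le> B2" "R (qs @ qs') m''"
    using assms(2) unfolding runs_def by blast
  then show ?thesis
    unfolding runs_def using exec.Seq[OF 1(1)] 1(2) by (meson add_mono le_refl)
qed

lemma runs_assign_seq:
  assumes "runs P d (store m x (val m e) (val m f) (val m g)) B R"
  shows "runs P (Seq (Assign x e f g) d) m (2 + B) R"
proof -
  have "runs P (Seq (Assign x e f g) d) m (1 + 1 + B) R"
    by (rule runs_seq[OF runs_assign]) (use assms in simp)
  then show ?thesis by (simp only: one_add_one)
qed

lemma runs_if: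
  assumes "val m e \<noteq> 0 \<Longrightarrow> runs P c m B R" "val m e = 0 \<Longrightarrow> runs P d m B R"
  shows "runs P (If e c d) m (1 + B) R"
  using assms exec.IfTrue exec.IfFalse unfolding runs_def
  by (metis add_le_cancel_left)

abbreviation Var :: "string \<Rightarrow> exp" where
  "Var x \<equiv> Cell x (Const 0) (Const 0)"

abbreviation Set :: "string \<Rightarrow> exp \<Rightarrow> com" where
  "Set x e \<equiv> Assign x (Const 0) (Const 0) e"

definition for_upto :: "string \<Rightarrow> string \<Rightarrow> com \<Rightarrow> com" where
  "for_upto x y c =
    Seq (Set x (Const 0)) (While (Minus (Var y) (Var x)) (Seq c (Set x (Plus (Var x) (Const 1)))))"

lemma store_apply [simp]:
  "store m x i j c y a b = (if y = x \<and> a = i \<and> b = j then c else m y a b)"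
  by (auto simp: store_def)

lemma store_other [simp]: "y \<noteq> x \<Longrightarrow> store m x i j c y = m y"
  by (auto simp: store_def)

lemma store_notin: "x \<notin> Y \<Longrightarrow> y \<in> Y \<Longrightarrow> store m x i j c y = m y"
  by (rule store_other) auto

text \<open>The bound uses \<open>s\<close> in place of the actual number \<open>N\<close> of
  rounds: with the input size for \<open>s\<close>, nested loops get bounds that depend on the input
  size alone.\<close>

lemma runs_for:
  assumes xy: "x \<noteq> y" and N: "m y 0 0 = N" "N \<le> s"
    and init: "Inv 0 [] (store m x 0 0 0)"
    and step: "\<And>i qs m'. i < N \<Longrightarrow> Inv i qs m' \<Longrightarrow> m' x 0 0 = i \<Longrightarrow> m' y 0 0 = N \<Longrightarrow>
      runs P c m' B (\<lambda>qs' m''. m'' x 0 0 = i \<and> m'' y 0 0 = N \<and>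
        Inv (Suc i) (qs @ qs') (store m'' x 0 0 (Suc i)))"
    and final: "\<And>qs m'. Inv N qs m' \<Longrightarrow> m' x 0 0 = N \<Longrightarrow> m' y 0 0 = N \<Longrightarrow> R qs m'"
  shows "runs P (for_upto x y c) m (s * (B + 3) + 3) R"
proof -
  let ?w = "While (Minus (Var y) (Var x)) (Seq c (Set x (Plus (Var x) (Const 1))))"
  have loop: "\<exists>T qs' m''. exec P ?w m' T qs' m'' \<and> T \<le> (N - i) * (B + 3) + 1 \<and> R (qs @ qs') m''"
    if "i \<le> N" "Inv i qs m'" "m' x 0 0 = i" "m' y 0 0 = N" for i qs m'
    using that
  proof (induction "N - i" arbitrary: i qs m')
    case 0
    then have "exec P ?w m' 1 [] m'"
      by (intro exec.WhileFalse) auto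
    moreover have "R (qs @ []) m'"
      using 0 final by auto
    ultimately show ?case by fastforce
  next
    case (Suc d)
    then have "i < N" by simp
    then obtain T1 qs1 m1 where 1: "exec P c m' T1 qs1 m1" "T1 \<le> B" "m1 x 0 0 = i" "m1 y 0 0 = N"
        "Inv (Suc i) (qs @ qs1) (store m1 x 0 0 (Suc i))"
      using step[OF _ Suc.prems(2-4)] by (auto simp: runs_def)
    have d: "d = N - Suc i" using Suc.hyps(2) by simp
    let ?m2 = "store m1 x 0 0 (Suc i)"
    have "exec P (Set x (Plus (Var x) (Const 1))) m1 1 [] ?m2"
      using exec.Assign[of P x "Const 0" "Const 0" "Plus (Var x) (Const 1)" m1] 1(3) by simp
    from exec.Seq[OF 1(1) this]
    have body: "exec P (Seq c (Set x (Plus (Var x) (Const 1)))) m' (1 + T1 + 1) qs1 ?m2" by simp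
    obtain T2 qs2 m3 where 3: "exec P ?w ?m2 T2 qs2 m3" "T2 \<le> (N - Suc i) * (B + 3) + 1"
        "R ((qs @ qs1) @ qs2) m3"
      using Suc.hyps(1)[OF d _ 1(5)] \<open>i < N\<close> 1(4) xy d by auto
    have "exec P ?w m' (1 + (1 + T1 + 1) + T2) (qs1 @ qs2) m3"
      using \<open>i < N\<close> Suc.prems by (intro exec.WhileTrue[OF _ body 3(1)]) auto
    moreover have "N - i = Suc (N - Suc i)"
      using \<open>i < N\<close> by simp
    \<comment> \<open>Besides its body, a round pays for the loop test, the sequential composition
      and the increment; this is the 3 in \<open>B + 3\<close>.\<close>
    then have "1 + (1 + T1 + 1) + T2 \<le> (N - i) * (B + 3) + 1"
      using 1(2) 3(2) by simp
    ultimately show ?case using 3(3) by fastforce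
  qed
  let ?m0 = "store m x 0 0 0"
  obtain T qs m' where 1: "exec P ?w ?m0 T qs m'" "T \<le> N * (B + 3) + 1" "R qs m'"
    using loop[of 0 "[]" ?m0] init xy N by auto
  have "exec P (Set x (Const 0)) m 1 [] ?m0"
    using exec.Assign[of P x "Const 0" "Const 0" "Const 0" m] by simp
  from exec.Seq[OF this 1(1)]
  have "exec P (for_upto x y c) m (1 + 1 + T) qs m'" by (simp add: for_upto_def)
  moreover have "1 + 1 + T \<le> s * (B + 3) + 3"
    using 1(2) mult_le_mono1[OF N(2), of "B + 3"] by linarith
  ultimately show ?thesis using 1(3) unfolding runs_def by blast
qed

text \<open>Truncated subtraction supplies the truth values: 1 - e is 1 if e is 0 and 0 otherwise.
  Conjunction is obtained by De Morgan, equality from both differences being 0.\<close>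

definition NotE :: "exp \<Rightarrow> exp" where "NotE e = Minus (Const 1) e"
definition AndE :: "exp \<Rightarrow> exp \<Rightarrow> exp" where "AndE e f = NotE (Plus (NotE e) (NotE f))"
definition EqE :: "exp \<Rightarrow> exp \<Rightarrow> exp" where "EqE e f = NotE (Plus (Minus e f) (Minus f e))"
definition LeE :: "exp \<Rightarrow> exp \<Rightarrow> exp" where "LeE e f = NotE (Minus e f)"

lemma val_NotE [simp]: "val m (NotE e) = of_bool (val m e = 0)"
  by (simp add: NotE_def)

lemma val_AndE [simp]: "val m (AndE e f) = of_bool (val m e \<noteq> 0 \<and> val m f \<noteq> 0)"
  by (simp add: AndE_def)

lemma val_EqE [simp]: "val m (EqE e f) = of_bool (val m e = val m f)"
  by (auto simp: EqE_def)

lemma val_LeE [simp]: "val m (LeE e f) = of_bool (val m e \<le> val m f)"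
  by (simp add: LeE_def)

text \<open>One summation loop serves for degrees, ball sizes, numbers of common neighbours and, in
  place of a multiplication, for D^2 as the sum of D copies of D.\<close>

definition accumulate :: "string \<Rightarrow> string \<Rightarrow> string \<Rightarrow> exp \<Rightarrow> com" where
  "accumulate z x y e = Seq (Set z (Const 0)) (for_upto x y (Set z (Plus (Var z) e)))"

text \<open>Both the counter and the accumulator change during the loop, so the summand is evaluated
  with \<open>i\<close> in the first and an arbitrary value \<open>c\<close> in the second.\<close>

lemma runs_accumulate:
  assumes ne: "x \<noteq> y" "x \<noteq> z" "y \<noteq> z" and N: "m y 0 0 = N" "N \<le> s"
    and e: "\<And>i c. i < N \<Longrightarrow> val (store (store m x 0 0 i) z 0 0 c) e = g i"
  shows "runs P (accumulate z x y e) m (s * 4 + 5)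
    (\<lambda>qs m'. qs = [] \<and> m' = store (store m x 0 0 N) z 0 0 (\<Sum>i<N. g i))"
  (is "runs P _ m _ ?R")
proof -
  let ?acc = "\<lambda>i. store (store m x 0 0 i) z 0 0 (\<Sum>j<i. g j)"
  have 1: "runs P (for_upto x y (Set z (Plus (Var z) e))) (store m z 0 0 0) (s * (1 + 3) + 3) ?R"
  proof (rule runs_for[where Inv = "\<lambda>i qs m'. qs = [] \<and> m' = ?acc i"])
    fix i and qs :: "club_inst list" and m' assume "i < N" "qs = [] \<and> m' = ?acc i"
    moreover have "store (store (?acc i) z 0 0 a) x 0 0 b = store (store m x 0 0 b) z 0 0 a" for a b
      using ne by (auto simp: fun_eq_iff)
    ultimately show "runs P (Set z (Plus (Var z) e)) m' 1 (\<lambda>qs' m''. m'' x 0 0 = i \<and> m'' y 0 0 = N \<and>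
        qs @ qs' = [] \<and> store m'' x 0 0 (Suc i) = ?acc (Suc i))"
      using ne N by (intro runs_mono[OF runs_assign]) (auto simp: e)
  qed (use ne N in \<open>auto simp: fun_eq_iff\<close>)
  have "runs P (accumulate z x y e) m (2 + (s * (1 + 3) + 3)) ?R"
    unfolding accumulate_def by (rule runs_assign_seq) (use 1 in simp)
  then show ?thesis by (rule runs_mono) auto
qed

section \<open>The reduction\<close>

text \<open>
  \<open>trivial n t k\<close> covers the yes-instances whose solution need not be a nonempty 2-club, and
  \<open>moore D t k\<close> is the answer on a Moore graph of degree \<open>D\<close>.
\<close>
locale club_problem =
  fixes P :: "club_inst \<Rightarrow> bool"
    and Q :: "nat \<Rightarrow> (nat \<Rightarrow> nat \<Rightarrow> bool) \<Rightarrow> nat set \<Rightarrow> bool"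
    and trivial moore :: "nat \<Rightarrow> nat \<Rightarrow> nat \<Rightarrow> bool"
    and trivial_exp moore_exp :: exp
  assumes P_iff: "pair_graph G \<Longrightarrow> P (G, t, k) \<longleftrightarrow> (\<exists>S\<subseteq>pverts G. Q t (adj G) S \<and> k \<le> card S)"
    and Q_image: "\<And>L S E E'. inj_on L S \<Longrightarrow>
      (\<And>i j. i \<in> S \<Longrightarrow> j \<in> S \<Longrightarrow> E' i j \<longleftrightarrow> E (L i) (L j)) \<Longrightarrow> Q t E (L ` S) \<longleftrightarrow> Q t E' S"
    and trivial_sound: "trivial n t k \<Longrightarrow> \<exists>S\<subseteq>{..<n}. Q t E S \<and> k \<le> card S"
    and club_or_trivial: "S \<subseteq> {..<n} \<Longrightarrow> Q t E S \<Longrightarrow> k \<le> card S \<Longrightarrow>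
      trivial n t k \<or> S \<noteq> {} \<and> club E S"
    and moore_sound: "moore_ball V E D c \<Longrightarrow> moore D t k \<Longrightarrow> \<exists>S\<subseteq>V. Q t E S \<and> k \<le> card S"
    and moore_complete: "moore_ball V E D c \<Longrightarrow> S \<subseteq> bounded_graph.ball V E c \<Longrightarrow> Q t E S \<Longrightarrow>
      k \<le> card S \<Longrightarrow> moore D t k"
    and val_trivial_exp: "val m trivial_exp \<noteq> 0 \<longleftrightarrow>
      trivial (m ''n'' 0 0) (m ''t'' 0 0) (m ''k'' 0 0)"
    and val_moore_exp: "m ''S'' 0 0 = (m ''D'' 0 0)\<^sup>2 \<Longrightarrow> val m moore_exp \<noteq> 0 \<longleftrightarrow>
      moore (m ''D'' 0 0) (m ''t'' 0 0) (m ''k'' 0 0)"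

text \<open>
  \<open>D\<close> is the maximum degree, \<open>S\<close> its square, \<open>R\<close> the relation of having distance at most two, and
  \<open>m\<close> the length of the list \<open>L\<close> of the vertices of the queried graph \<open>H\<close>.
\<close>

definition degree_com :: com where
  "degree_com = Seq (Set ''D'' (Const 0))
    (for_upto ''v'' ''n'' (Seq (accumulate ''d'' ''u'' ''n'' (Cell ''adj'' (Var ''v'') (Var ''u'')))
      (Set ''D'' (Plus (Var ''D'') (Minus (Var ''d'') (Var ''D''))))))"

text \<open>The double negation reduces the sum to 0 or 1, so that summing a row of \<open>R\<close>
  gives the size of a ball.\<close>

definition near_com :: com where
  "near_com = for_upto ''x'' ''n'' (for_upto ''y'' ''n'' (Seq
    (accumulate ''d'' ''z'' ''n''
      (AndE (Cell ''adj'' (Var ''x'') (Var ''z'')) (Cell ''adj'' (Var ''z'') (Var ''y''))))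
    (Assign ''R'' (Var ''x'') (Var ''y'') (NotE (NotE
      (Plus (EqE (Var ''x'') (Var ''y'')) (Plus (Cell ''adj'' (Var ''x'') (Var ''y'')) (Var ''d''))))))))"

text \<open>Every \<open>u\<close> is written behind the end of the list, but the length grows only
  if \<open>u\<close> belongs to it; a rejected entry is overwritten or stays beyond the
  end.\<close>

definition list_com :: "string \<Rightarrow> com" where
  "list_com w = Seq (Set ''m'' (Const 0)) (for_upto ''u'' ''n'' (Seq
    (Assign ''L'' (Var ''m'') (Const 0) (Var ''u''))
    (Set ''m'' (Plus (Var ''m'')
      (AndE (Cell ''R'' (Var ''v'') (Var ''u'')) (NotE (EqE (Var ''u'') (Var w))))))))"

definition copy_com :: com where
  "copy_com = for_upto ''i'' ''m'' (for_upto ''j'' ''m''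
    (Assign ''H'' (Var ''i'') (Var ''j'')
      (Cell ''adj'' (Cell ''L'' (Var ''i'') (Const 0)) (Cell ''L'' (Var ''j'') (Const 0)))))"

text \<open>Adding answers to \<open>out\<close> implements "or", since acceptance only asks whether
  \<open>out\<close> is nonzero.\<close>

definition ask_com :: "string \<Rightarrow> com" where
  "ask_com w = Seq (list_com w) (Seq copy_com (Seq
    (Query ''ans'' ''H'' (Var ''m'') (Var ''t'') (Var ''k''))
    (Set ''out'' (Plus (Var ''out'') (Var ''ans'')))))"

text \<open>There is no early exit: a later pair at distance more than two replaces an earlier
  one.\<close>

definition search_com :: com where
  "search_com = Seq (Set ''f'' (Const 0)) (for_upto ''x'' ''n'' (for_upto ''y'' ''n''
    (If (AndE (AndE (Cell ''R'' (Var ''v'') (Var ''x'')) (Cell ''R'' (Var ''v'') (Var ''y'')))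
          (NotE (Cell ''R'' (Var ''x'') (Var ''y''))))
      (Seq (Set ''a'' (Var ''x'')) (Seq (Set ''b'' (Var ''y'')) (Set ''f'' (Const 1))))
      Skip)))"

text \<open>The assignment \<open>a := n\<close> makes \<open>ask_com a\<close> remove nothing from the ball.\<close>
definition vertex_com :: "exp \<Rightarrow> com" where
  "vertex_com e = Seq (accumulate ''d'' ''u'' ''n'' (Cell ''R'' (Var ''v'') (Var ''u'')))
    (If (LeE (Var ''d'') (Var ''S''))
      (Seq (Set ''a'' (Var ''n'')) (ask_com ''a''))
      (Seq search_com (If (Var ''f'')
        (Seq (ask_com ''a'') (ask_com ''b''))
        (Set ''out'' (Plus (Var ''out'') e)))))"

definition main_com :: "exp \<Rightarrow> exp \<Rightarrow> com" where
  "main_com e e' = Seq degree_com (Seq (accumulate ''S'' ''i'' ''D'' (Var ''D'')) (Seq near_com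
    (Seq (Set ''out'' e) (for_upto ''v'' ''n'' (vertex_com e')))))"

section \<open>A fixed instance and the meaning of its queries\<close>

locale club_instance = club_problem +
  fixes G :: "nat pair_pre_digraph" and n t k :: nat
  assumes pair_graph: "pair_graph G" and verts: "pverts G = {..<n}"
begin

abbreviation "E \<equiv> adj G"
abbreviation "D \<equiv> max_degree G"

lemma D_eq: "D = Max (insert 0 ((\<lambda>v. card {u. E v u}) ` {..<n}))"
  by (simp add: max_degree_eq verts)

sublocale bounded_graph "{..<n}" E D
proof -
  interpret G: pair_graph G by (rule pair_graph)
  show "bounded_graph {..<n} E D"
  proof
    show "u \<in> {..<n} \<and> v \<in> {..<n}" if "E u v" for u v
      using G.in_arcsD1[OF that] G.in_arcsD2[OF that] verts by simp
    show "E v u" if "E u v" for u v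
      using that G.sym_arcs by (auto simp: symmetric_def sym_def)
    show "\<not> E u u" for u
      using G.pair_no_loops[of "(u, u)"] by auto
    show "card {u. E v u} \<le> D" if "v \<in> {..<n}" for v
      unfolding D_eq using that by (intro Max_ge) auto
  qed simp
qed

lemma D_le: "D \<le> n"
proof -
  have "card {u. E v u} \<le> n" for v
    using card_mono[of "{..<n}" "{u. E v u}"] by (auto dest: edge_in_V)
  then show ?thesis by (simp add: D_eq)
qed

definition bits :: nat where
  "bits = inst_size (G, t, k)"

lemma inst_size_le: "pverts H = {..<m} \<Longrightarrow> m \<le> n \<Longrightarrow> inst_size (H, t, k) \<le> bits"
  by (simp add: bits_def inst_size_def verts power_mono)

lemma n_le_s: "n \<le> bits"
  by (cases n) (simp_all add: bits_def inst_size_def verts power2_eq_square)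

definition solvable :: "nat set \<Rightarrow> bool" where
  "solvable X \<longleftrightarrow> (\<exists>S\<subseteq>X. Q t E S \<and> k \<le> card S)"

text \<open>The matrix \<open>h\<close> describes the subgraph induced on \<open>X\<close>, numbered
  by \<open>l\<close>. Solutions in it correspond to solutions inside \<open>X\<close> of the
  original graph by \<open>Q_image\<close>; the symmetrization in \<open>graph_of_matrix\<close>
  changes nothing because \<open>E\<close> is symmetric.\<close>

lemma P_query:
  assumes "inj_on l {..<c}" "l ` {..<c} = X"
    and h: "\<And>i j. i < c \<Longrightarrow> j < c \<Longrightarrow> h i j = of_bool (E (l i) (l j))"
  shows "P (graph_of_matrix c h, t, k) \<longleftrightarrow> solvable X"
proof -
  have adj: "adj (graph_of_matrix c h) i j \<longleftrightarrow> E (l i) (l j)" if "i < c" "j < c" for i j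
    using that edge_sym edge_irrefl by (auto simp: graph_of_matrix_def h)
  have Q: "Q t E (l ` S) \<longleftrightarrow> Q t (adj (graph_of_matrix c h)) S" "card (l ` S) = card S"
    if S: "S \<subseteq> {..<c}" for S
  proof -
    have inj: "inj_on l S" using assms(1) S by (rule inj_on_subset)
    have "adj (graph_of_matrix c h) i j \<longleftrightarrow> E (l i) (l j)" if "i \<in> S" "j \<in> S" for i j
      using that S by (intro adj) auto
    then show "Q t E (l ` S) \<longleftrightarrow> Q t (adj (graph_of_matrix c h)) S"
      by (rule Q_image[OF inj])
    show "card (l ` S) = card S" by (rule card_image[OF inj])
  qed
  have "P (graph_of_matrix c h, t, k) \<longleftrightarrow>
      (\<exists>S\<subseteq>{..<c}. Q t (adj (graph_of_matrix c h)) S \<and> k \<le> card S)"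
    by (subst P_iff[OF pair_graph_graph_of_matrix]) (simp add: graph_of_matrix_def)
  also have "\<dots> \<longleftrightarrow> (\<exists>S. S \<subseteq> {..<c} \<and> Q t E (l ` S) \<and> k \<le> card (l ` S))"
    by (intro ex_cong1 conj_cong refl) (simp_all only: Q)
  also have "\<dots> \<longleftrightarrow> solvable (l ` {..<c})"
    unfolding solvable_def
    using all_image_subset_iff[of l "{..<c}" "\<lambda>T. \<not> (Q t E T \<and> k \<le> card T)"] by blast
  finally show ?thesis by (simp only: assms(2))
qed

section \<open>Memory contents and the computation of \<open>D\<close> and \<open>R\<close>\<close>

definition input :: "memory \<Rightarrow> bool" where
  "input m \<longleftrightarrow> (\<forall>i j. m ''adj'' i j = of_bool (E i j)) \<and>
    m ''n'' 0 0 = n \<and> m ''t'' 0 0 = t \<and> m ''k'' 0 0 = k"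

lemma input_store [simp]:
  "x \<notin> {''adj'', ''n'', ''t'', ''k''} \<Longrightarrow> input (store m x i j c) \<longleftrightarrow> input m"
proof -
  assume x: "x \<notin> {''adj'', ''n'', ''t'', ''k''}"
  have "store m x i j c y = m y" if "y \<in> {''adj'', ''n'', ''t'', ''k''}" for y
    using x that by (rule store_notin)
  then show ?thesis unfolding input_def by (simp only: insert_iff simp_thms)
qed

lemma input_sel:
  "input m \<Longrightarrow> m ''adj'' i j = of_bool (E i j)"
  "input m \<Longrightarrow> m ''n'' 0 0 = n"
  "input m \<Longrightarrow> m ''t'' 0 0 = t"
  "input m \<Longrightarrow> m ''k'' 0 0 = k"
  by (auto simp: input_def)

lemma input_memory: "input (input_memory (G, t, k))"
  by (simp add: input_def input_memory_def verts)

lemma runs_degree_com: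
  assumes "input m"
  shows "runs P degree_com m (2 + (bits * ((1 + (bits * 4 + 5) + 1) + 3) + 3))
    (\<lambda>qs m'. qs = [] \<and> input m' \<and> m' ''D'' 0 0 = D)"
proof -
  let ?D = "\<lambda>i. Max (insert 0 ((\<lambda>v. card {u. E v u}) ` {..<i}))"
  \<comment> \<open>The program updates \<open>D\<close> to D + (d - D), which with truncated
    subtraction is the maximum of both.\<close>
  have D_Suc: "?D (Suc i) = max (card {u. E i u}) (?D i)" for i
  proof -
    have "insert 0 ((\<lambda>v. card {u. E v u}) ` {..<Suc i}) =
        insert (card {u. E i u}) (insert 0 ((\<lambda>v. card {u. E v u}) ` {..<i}))"
      by (auto simp: lessThan_Suc)
    then show ?thesis by (simp only:) (rule Max_insert, auto)
  qed
  have deg: "card {u. E i u} = (\<Sum>u<n. of_bool (E i u))" for i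
  proof -
    have "{u. E i u} = {..<n} \<inter> {u. E i u}" by (auto dest: edge_in_V)
    then show ?thesis by simp
  qed
  show ?thesis
    unfolding degree_com_def
  proof (rule runs_assign_seq, rule runs_for[where N = n and Inv = "\<lambda>i qs m'. qs = [] \<and> input m' \<and> m' ''D'' 0 0 = ?D i"])
    fix i and qs :: "club_inst list" and m' :: memory
    assume *: "i < n" "qs = [] \<and> input m' \<and> m' ''D'' 0 0 = ?D i" "m' ''v'' 0 0 = i"
      "m' ''n'' 0 0 = n"
    show "runs P (Seq (accumulate ''d'' ''u'' ''n'' (Cell ''adj'' (Var ''v'') (Var ''u'')))
      (Set ''D'' (Plus (Var ''D'') (Minus (Var ''d'') (Var ''D''))))) m' (1 + (bits * 4 + 5) + 1)
      (\<lambda>qs' m''. m'' ''v'' 0 0 = i \<and> m'' ''n'' 0 0 = n \<and>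
        qs @ qs' = [] \<and> input (store m'' ''v'' 0 0 (Suc i)) \<and>
        store m'' ''v'' 0 0 (Suc i) ''D'' 0 0 = ?D (Suc i))"
      by (rule runs_seq[OF runs_accumulate[where N = n and g = "\<lambda>u. of_bool (E i u)"]])
        (use * n_le_s in \<open>auto intro!: runs_mono[OF runs_assign] simp del: sum_of_bool_eq
          simp: input_sel D_Suc deg[symmetric] max_def\<close>)
  qed (use assms n_le_s in \<open>auto simp: input_sel D_eq\<close>)
qed

definition prepared :: "memory \<Rightarrow> bool" where
  "prepared m \<longleftrightarrow> input m \<and> m ''D'' 0 0 = D \<and> m ''S'' 0 0 = D\<^sup>2 \<and>
    (\<forall>x<n. \<forall>y<n. m ''R'' x y = of_bool (near E {..<n} x y))"

text \<open>The entries before (i, j) in lexicographic order are correct. This is the invariant of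
  both nested loops, as completing row \<open>i\<close> turns \<open>table i n\<close> into
  \<open>table (Suc i) 0\<close>.\<close>

definition table :: "nat \<Rightarrow> nat \<Rightarrow> memory \<Rightarrow> bool" where
  "table i j m \<longleftrightarrow> (\<forall>x<n. \<forall>y<n. x < i \<or> x = i \<and> y < j \<longrightarrow> m ''R'' x y = of_bool (near E {..<n} x y))"

lemma table_other [simp]: "x \<noteq> ''R'' \<Longrightarrow> table i j (store m x a b c) \<longleftrightarrow> table i j m"
  by (simp add: table_def)

lemma table_step:
  "table i j m \<Longrightarrow> table i (Suc j) (store m ''R'' i j (of_bool (near E {..<n} i j)))"
  by (auto simp: table_def)

lemma near_sum:
  "near E {..<n} x y \<longleftrightarrow> x = y \<or> E x y \<or> (\<Sum>z<n. of_bool (E x z \<and> E z y)) \<noteq> (0::nat)"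
  by (auto simp: near_def simp del: sum_of_bool_eq)

lemma runs_near_com:
  assumes "input m" "m ''D'' 0 0 = D" "m ''S'' 0 0 = D\<^sup>2"
  shows "runs P near_com m (bits * ((bits * ((1 + (bits * 4 + 5) + 1) + 3) + 3) + 3) + 3)
    (\<lambda>qs m'. qs = [] \<and> prepared m')"
proof -
  let ?I = "\<lambda>i j m'. input m' \<and> m' ''D'' 0 0 = D \<and> m' ''S'' 0 0 = D\<^sup>2 \<and> table i j m'"
  let ?e = "AndE (Cell ''adj'' (Var ''x'') (Var ''z'')) (Cell ''adj'' (Var ''z'') (Var ''y''))"
  let ?f = "NotE (NotE (Plus (EqE (Var ''x'') (Var ''y''))
    (Plus (Cell ''adj'' (Var ''x'') (Var ''y'')) (Var ''d''))))"
  let ?c = "Seq (accumulate ''d'' ''z'' ''n'' ?e) (Assign ''R'' (Var ''x'') (Var ''y'') ?f)"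
  show ?thesis
    unfolding near_com_def
  proof (rule runs_for[where N = n and Inv = "\<lambda>i qs m'. qs = [] \<and> ?I i 0 m'"])
    fix i and qs :: "club_inst list" and m' :: memory
    assume 1: "i < n" "qs = [] \<and> ?I i 0 m'" "m' ''x'' 0 0 = i" "m' ''n'' 0 0 = n"
    show "runs P (for_upto ''y'' ''n'' ?c) m' (bits * ((1 + (bits * 4 + 5) + 1) + 3) + 3)
      (\<lambda>qs' m''. m'' ''x'' 0 0 = i \<and> m'' ''n'' 0 0 = n \<and> qs @ qs' = [] \<and>
        ?I (Suc i) 0 (store m'' ''x'' 0 0 (Suc i)))"
    proof (rule runs_for[where N = n and Inv = "\<lambda>j qs m'. qs = [] \<and> ?I i j m' \<and> m' ''x'' 0 0 = i"])
      fix j and qs :: "club_inst list" and m' :: memory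
      assume 2: "j < n" "qs = [] \<and> ?I i j m' \<and> m' ''x'' 0 0 = i" "m' ''y'' 0 0 = j"
        "m' ''n'' 0 0 = n"
      show "runs P ?c m' (1 + (bits * 4 + 5) + 1)
        (\<lambda>qs' m''. m'' ''y'' 0 0 = j \<and> m'' ''n'' 0 0 = n \<and> qs @ qs' = [] \<and>
          ?I i (Suc j) (store m'' ''y'' 0 0 (Suc j)) \<and> store m'' ''y'' 0 0 (Suc j) ''x'' 0 0 = i)"
      proof (rule runs_seq[OF runs_accumulate[where N = n and g = "\<lambda>z. of_bool (E i z \<and> E z j)"]])
        define \<sigma> :: nat where "\<sigma> = (\<Sum>z<n. of_bool (E i z \<and> E z j))"
        let ?m1 = "store (store m' ''z'' 0 0 n) ''d'' 0 0 \<sigma>"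
        fix qs' :: "club_inst list" and m1 :: memory
        assume "qs' = [] \<and> m1 = store (store m' ''z'' 0 0 n) ''d'' 0 0 (\<Sum>z<n. of_bool (E i z \<and> E z j))"
        then have m1: "qs' = [] \<and> m1 = ?m1" by (simp only: \<sigma>_def)
        have near: "near E {..<n} i j \<longleftrightarrow> i = j \<or> E i j \<or> \<sigma> \<noteq> 0"
          unfolding \<sigma>_def by (rule near_sum)
        have f: "val ?m1 ?f = of_bool (near E {..<n} i j)"
          using 2 by (simp add: near input_sel)
        show "runs P (Assign ''R'' (Var ''x'') (Var ''y'') ?f) m1 1
          (\<lambda>qs''. (\<lambda>qs' m''. m'' ''y'' 0 0 = j \<and> m'' ''n'' 0 0 = n \<and> qs @ qs' = [] \<and>
            ?I i (Suc j) (store m'' ''y'' 0 0 (Suc j)) \<and> store m'' ''y'' 0 0 (Suc j) ''x'' 0 0 = i)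
            (qs' @ qs''))"
        proof (rule runs_mono[OF runs_assign le_refl])
          fix qs'' :: "club_inst list" and m'' :: memory
          assume "qs'' = [] \<and> m'' = store m1 ''R'' (val m1 (Var ''x'')) (val m1 (Var ''y'')) (val m1 ?f)"
          then have m2: "qs'' = []" "m'' = store ?m1 ''R'' i j (of_bool (near E {..<n} i j))"
            using 2 m1 f by (simp_all del: val_NotE)
          have "table i (Suc j) m''"
            unfolding m2 using 2 by (intro table_step) simp
          then show "m'' ''y'' 0 0 = j \<and> m'' ''n'' 0 0 = n \<and> qs @ qs' @ qs'' = [] \<and>
            ?I i (Suc j) (store m'' ''y'' 0 0 (Suc j)) \<and> store m'' ''y'' 0 0 (Suc j) ''x'' 0 0 = i"
            using 2 m1 m2 by simp
        qed
      qed (use 2 n_le_s in \<open>auto simp: input_sel\<close>)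
    qed (use 1 n_le_s in \<open>auto simp: table_def less_Suc_eq\<close>)
  qed (use assms n_le_s in \<open>auto simp: input_sel prepared_def table_def\<close>)
qed

lemma prepared_store [simp]:
  "x \<notin> {''adj'', ''n'', ''t'', ''k'', ''D'', ''S'', ''R''} \<Longrightarrow> prepared (store m x i j c) \<longleftrightarrow> prepared m"
proof -
  assume x: "x \<notin> {''adj'', ''n'', ''t'', ''k'', ''D'', ''S'', ''R''}"
  have "store m x i j c y = m y" if "y \<in> {''adj'', ''n'', ''t'', ''k'', ''D'', ''S'', ''R''}" for y
    using x that by (rule store_notin)
  moreover have "input (store m x i j c) \<longleftrightarrow> input m"
    by (rule input_store, rule contra_subsetD[OF _ x]) auto
  ultimately show ?thesis unfolding prepared_def by (simp only: insert_iff simp_thms)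
qed

text \<open>The state on which a query relies. Tracking \<open>a\<close> and \<open>b\<close> is
  essential, since the query without \<open>b\<close> follows the one without
  \<open>a\<close>.\<close>

definition ready :: "nat \<Rightarrow> nat \<Rightarrow> nat \<Rightarrow> nat \<Rightarrow> memory \<Rightarrow> bool" where
  "ready v r a b m \<longleftrightarrow> prepared m \<and> m ''v'' 0 0 = v \<and> m ''out'' 0 0 = r \<and> m ''a'' 0 0 = a \<and> m ''b'' 0 0 = b"

lemma ready_store [simp]:
  "x \<notin> {''adj'', ''n'', ''t'', ''k'', ''D'', ''S'', ''R'', ''v'', ''out'', ''a'', ''b''} \<Longrightarrow>
    ready v r a b (store m x i j c) \<longleftrightarrow> ready v r a b m"
proof -
  assume x: "x \<notin> {''adj'', ''n'', ''t'', ''k'', ''D'', ''S'', ''R'', ''v'', ''out'', ''a'', ''b''}"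
  have "store m x i j c y = m y" if "y \<in> {''adj'', ''n'', ''t'', ''k'', ''D'', ''S'', ''R'', ''v'', ''out'', ''a'', ''b''}" for y
    using x that by (rule store_notin)
  moreover have "prepared (store m x i j c) \<longleftrightarrow> prepared m"
    by (rule prepared_store, rule contra_subsetD[OF _ x]) auto
  ultimately show ?thesis unfolding ready_def by (simp only: insert_iff simp_thms)
qed

lemma prepared_sel:
  assumes "prepared m"
  shows "m ''adj'' i j = of_bool (E i j)" "m ''n'' 0 0 = n" "m ''t'' 0 0 = t" "m ''k'' 0 0 = k"
    "m ''D'' 0 0 = D" "m ''S'' 0 0 = D\<^sup>2"
    "x < n \<Longrightarrow> y < n \<Longrightarrow> m ''R'' x y = of_bool (near E {..<n} x y)"
  using assms by (auto simp: prepared_def input_def)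

section \<open>Assembling and submitting one query\<close>

definition listed :: "nat set \<Rightarrow> memory \<Rightarrow> bool" where
  "listed X m \<longleftrightarrow> inj_on (\<lambda>i. m ''L'' i 0) {..<m ''m'' 0 0} \<and> (\<lambda>i. m ''L'' i 0) ` {..<m ''m'' 0 0} = X"

lemma listed_other [simp]: "x \<notin> {''L'', ''m''} \<Longrightarrow> listed X (store m x a b c) \<longleftrightarrow> listed X m"
proof -
  assume x: "x \<notin> {''L'', ''m''}"
  have "store m x a b c y = m y" if "y \<in> {''L'', ''m''}" for y
    using x that by (rule store_notin)
  then show ?thesis unfolding listed_def by (simp only: insert_iff simp_thms)
qed

lemma listed_card: "listed X m \<Longrightarrow> m ''m'' 0 0 = card X"
  by (auto simp: listed_def card_image)

lemma listed_insert:
  assumes "listed X m" "x \<notin> X"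
  shows "listed (insert x X) (store (store m ''L'' (m ''m'' 0 0) 0 x) ''m'' 0 0 (Suc (m ''m'' 0 0)))"
proof -
  let ?c = "m ''m'' 0 0" and ?l = "\<lambda>i. m ''L'' i 0"
  have l: "inj_on ?l {..<?c}" "?l ` {..<?c} = X" using assms by (simp_all add: listed_def)
  have inj: "inj_on (?l(?c := x)) {..<Suc ?c}"
    using l assms(2) by (auto simp: lessThan_Suc inj_on_def)
  have im: "(?l(?c := x)) ` {..<Suc ?c} = insert x X"
    using l by (auto simp: lessThan_Suc)
  have eq: "(\<lambda>i. store (store m ''L'' ?c 0 x) ''m'' 0 0 (Suc ?c) ''L'' i 0) = ?l(?c := x)"
    by (auto simp: fun_eq_iff)
  show ?thesis unfolding listed_def eq using inj im by simp
qed

text \<open>The cell written has the current length as its index and so lies just behind the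
  list.\<close>

lemma listed_overwrite:
  assumes "listed X m"
  shows "listed X (store (store m ''L'' (m ''m'' 0 0) 0 x) ''m'' 0 0 (m ''m'' 0 0))"
proof -
  let ?m = "store (store m ''L'' (m ''m'' 0 0) 0 x) ''m'' 0 0 (m ''m'' 0 0)"
  have eq: "?m ''L'' i 0 = m ''L'' i 0" if "i \<in> {..<m ''m'' 0 0}" for i
    using that by simp
  have m: "?m ''m'' 0 0 = m ''m'' 0 0" by simp
  show ?thesis
    using assms inj_on_cong[of _ "\<lambda>i. ?m ''L'' i 0" "\<lambda>i. m ''L'' i 0", OF eq]
      image_cong[of _ _ "\<lambda>i. ?m ''L'' i 0" "\<lambda>i. m ''L'' i 0", OF refl eq]
    unfolding listed_def m by (simp only:)
qed

lemma runs_list_com: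
  assumes "ready v r a b m" "v < n" "m w 0 0 = c" "w \<notin> {''L'', ''m'', ''u''}"
  shows "runs P (list_com w) m (2 + (bits * ((2 + 1) + 3) + 3))
    (\<lambda>qs m'. qs = [] \<and> ready v r a b m' \<and> listed (ball v - {c}) m')"
  unfolding list_com_def
proof (rule runs_assign_seq, rule runs_for[where N = n and Inv = "\<lambda>i qs m'. qs = [] \<and> ready v r a b m' \<and>
    m' w 0 0 = c \<and> listed (ball v \<inter> {..<i} - {c}) m'"])
  let ?f = "Plus (Var ''m'') (AndE (Cell ''R'' (Var ''v'') (Var ''u'')) (NotE (EqE (Var ''u'') (Var w))))"
  fix i and qs :: "club_inst list" and m' :: memory
  let ?c = "m' ''m'' 0 0"
  let ?m1 = "store m' ''L'' ?c 0 i"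
  let ?m2 = "store ?m1 ''m'' 0 0 (?c + of_bool (near E {..<n} v i \<and> i \<noteq> c))"
  assume *: "i < n" "qs = [] \<and> ready v r a b m' \<and> m' w 0 0 = c \<and> listed (ball v \<inter> {..<i} - {c}) m'"
    "m' ''u'' 0 0 = i" "m' ''n'' 0 0 = n"
  have f: "val ?m1 ?f = ?c + of_bool (near E {..<n} v i \<and> i \<noteq> c)"
    using * assms by (auto simp: ready_def prepared_def)
  have listed: "listed (ball v \<inter> {..<Suc i} - {c}) ?m2"
  proof (cases "near E {..<n} v i \<and> i \<noteq> c")
    case True
    then have "ball v \<inter> {..<Suc i} - {c} = insert i (ball v \<inter> {..<i} - {c})"
      using * by (auto simp: ball_def lessThan_Suc)
    then show ?thesis using True * listed_insert[of "ball v \<inter> {..<i} - {c}" m' i] by simp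
  next
    case False
    then have "ball v \<inter> {..<Suc i} - {c} = ball v \<inter> {..<i} - {c}"
      by (auto simp: ball_def lessThan_Suc)
    moreover have "of_bool (near E {..<n} v i \<and> i \<noteq> c) = (0::nat)" using False by simp
    ultimately show ?thesis
      using * listed_overwrite[of "ball v \<inter> {..<i} - {c}" m' i] by (simp only: add_0_right)
  qed
  show "runs P (Seq (Assign ''L'' (Var ''m'') (Const 0) (Var ''u'')) (Set ''m'' ?f)) m' (2 + 1)
    (\<lambda>qs' m''. m'' ''u'' 0 0 = i \<and> m'' ''n'' 0 0 = n \<and> qs @ qs' = [] \<and>
      ready v r a b (store m'' ''u'' 0 0 (Suc i)) \<and> store m'' ''u'' 0 0 (Suc i) w 0 0 = c \<and>
      listed (ball v \<inter> {..<Suc i} - {c}) (store m'' ''u'' 0 0 (Suc i)))"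
  proof (rule runs_assign_seq, rule runs_mono[OF runs_assign le_refl])
    fix qs' :: "club_inst list" and m'' :: memory
    assume "qs' = [] \<and> m'' = store (store m' ''L'' (val m' (Var ''m'')) (val m' (Const 0)) (val m' (Var ''u'')))
      ''m'' (val (store m' ''L'' (val m' (Var ''m'')) (val m' (Const 0)) (val m' (Var ''u''))) (Const 0))
        (val (store m' ''L'' (val m' (Var ''m'')) (val m' (Const 0)) (val m' (Var ''u''))) (Const 0))
        (val (store m' ''L'' (val m' (Var ''m'')) (val m' (Const 0)) (val m' (Var ''u''))) ?f)"
    then have "qs' = []" "m'' = ?m2" using f *(3) by simp_all
    then show "m'' ''u'' 0 0 = i \<and> m'' ''n'' 0 0 = n \<and> qs @ qs' = [] \<and>
      ready v r a b (store m'' ''u'' 0 0 (Suc i)) \<and> store m'' ''u'' 0 0 (Suc i) w 0 0 = c \<and>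
      listed (ball v \<inter> {..<Suc i} - {c}) (store m'' ''u'' 0 0 (Suc i))"
      using * assms(4) listed by simp
  qed
next
  fix qs :: "club_inst list" and m' :: memory
  assume *: "qs = [] \<and> ready v r a b m' \<and> m' w 0 0 = c \<and> listed (ball v \<inter> {..<n} - {c}) m'"
  have "ball v \<inter> {..<n} - {c} = ball v - {c}" using ball_subset by blast
  then show "qs = [] \<and> ready v r a b m' \<and> listed (ball v - {c}) m'" using * by simp
qed (use assms n_le_s in \<open>auto simp: ready_def prepared_sel listed_def\<close>)

definition copied :: "nat \<Rightarrow> nat \<Rightarrow> memory \<Rightarrow> bool" where
  "copied i j m \<longleftrightarrow> (\<forall>x<m ''m'' 0 0. \<forall>y<m ''m'' 0 0. x < i \<or> x = i \<and> y < j \<longrightarrow>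
    m ''H'' x y = of_bool (E (m ''L'' x 0) (m ''L'' y 0)))"

lemma copied_other [simp]: "x \<notin> {''H'', ''L'', ''m''} \<Longrightarrow> copied i j (store m x a b c) \<longleftrightarrow> copied i j m"
proof -
  assume x: "x \<notin> {''H'', ''L'', ''m''}"
  have "store m x a b c y = m y" if "y \<in> {''H'', ''L'', ''m''}" for y
    using x that by (rule store_notin)
  then show ?thesis unfolding copied_def by (simp only: insert_iff simp_thms)
qed

lemma copied_step:
  "copied i j m \<Longrightarrow> copied i (Suc j) (store m ''H'' i j (of_bool (E (m ''L'' i 0) (m ''L'' j 0))))"
  by (auto simp: copied_def)

lemma runs_copy_com:
  assumes "ready v r a b m" "listed X m" "card X \<le> n"
  shows "runs P copy_com m (bits * ((bits * (1 + 3) + 3) + 3) + 3)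
    (\<lambda>qs m'. qs = [] \<and> ready v r a b m' \<and> listed X m' \<and> copied (card X) 0 m')"
proof -
  let ?I = "\<lambda>i j m'. ready v r a b m' \<and> listed X m' \<and> copied i j m'"
  let ?c = "Assign ''H'' (Var ''i'') (Var ''j'')
    (Cell ''adj'' (Cell ''L'' (Var ''i'') (Const 0)) (Cell ''L'' (Var ''j'') (Const 0)))"
  have bits: "card X \<le> bits" using assms n_le_s by simp
  show ?thesis
    unfolding copy_com_def
  proof (rule runs_for[where N = "card X" and Inv = "\<lambda>i qs m'. qs = [] \<and> ?I i 0 m'"])
    fix i and qs :: "club_inst list" and m' :: memory
    assume 1: "i < card X" "qs = [] \<and> ?I i 0 m'" "m' ''i'' 0 0 = i" "m' ''m'' 0 0 = card X"
    show "runs P (for_upto ''j'' ''m'' ?c) m' (bits * (1 + 3) + 3)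
      (\<lambda>qs' m''. m'' ''i'' 0 0 = i \<and> m'' ''m'' 0 0 = card X \<and> qs @ qs' = [] \<and>
        ?I (Suc i) 0 (store m'' ''i'' 0 0 (Suc i)))"
    proof (rule runs_for[where N = "card X" and Inv = "\<lambda>j qs m'. qs = [] \<and> ?I i j m' \<and> m' ''i'' 0 0 = i"])
      fix j and qs :: "club_inst list" and m' :: memory
      assume 2: "j < card X" "qs = [] \<and> ?I i j m' \<and> m' ''i'' 0 0 = i" "m' ''j'' 0 0 = j"
        "m' ''m'' 0 0 = card X"
      show "runs P ?c m' 1
        (\<lambda>qs' m''. m'' ''j'' 0 0 = j \<and> m'' ''m'' 0 0 = card X \<and> qs @ qs' = [] \<and>
          ?I i (Suc j) (store m'' ''j'' 0 0 (Suc j)) \<and> store m'' ''j'' 0 0 (Suc j) ''i'' 0 0 = i)"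
      proof (rule runs_mono[OF runs_assign le_refl])
        fix qs' :: "club_inst list" and m'' :: memory
        assume "qs' = [] \<and> m'' = store m' ''H'' (val m' (Var ''i'')) (val m' (Var ''j''))
          (val m' (Cell ''adj'' (Cell ''L'' (Var ''i'') (Const 0)) (Cell ''L'' (Var ''j'') (Const 0))))"
        then have m2: "qs' = []" "m'' = store m' ''H'' i j (of_bool (E (m' ''L'' i 0) (m' ''L'' j 0)))"
          using 2 by (simp_all add: ready_def prepared_sel)
        have "copied i (Suc j) m''"
          unfolding m2 using 2 by (intro copied_step) simp
        then show "m'' ''j'' 0 0 = j \<and> m'' ''m'' 0 0 = card X \<and> qs @ qs' = [] \<and>
          ?I i (Suc j) (store m'' ''j'' 0 0 (Suc j)) \<and> store m'' ''j'' 0 0 (Suc j) ''i'' 0 0 = i"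
          using 2 m2 by simp
      qed
    qed (use 1 bits in \<open>auto simp: copied_def less_Suc_eq\<close>)
  qed (use assms bits in \<open>auto simp: copied_def listed_card\<close>)
qed

abbreviation ask_time :: nat where
  "ask_time \<equiv> 1 + (2 + (bits * ((2 + 1) + 3) + 3)) + (1 + (bits * ((bits * (1 + 3) + 3) + 3) + 3) + (1 + (1 + bits) + 1))"

lemma runs_ask_com:
  assumes "ready v r a b m" "v < n" "m w 0 0 = c" "w \<notin> {''L'', ''m'', ''u''}"
  shows "runs P (ask_com w) m ask_time (\<lambda>qs m'. \<exists>H. qs = [(H, t, k)] \<and>
    card (pverts H) = card (ball v - {c}) \<and> ready v (r + of_bool (solvable (ball v - {c}))) a b m')"
  unfolding ask_com_def
proof (rule runs_seq[OF runs_list_com[OF assms]], elim conjE)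
  let ?X = "ball v - {c}"
  let ?R = "\<lambda>qs m'. \<exists>H. qs = [(H, t, k)] \<and> card (pverts H) = card ?X \<and>
    ready v (r + of_bool (solvable ?X)) a b m'"
  have X: "card ?X \<le> n" using card_mono[of "{..<n}" ?X] ball_subset by auto
  fix qs1 :: "club_inst list" and m1 :: memory
  assume 1: "qs1 = []" "ready v r a b m1" "listed ?X m1"
  show "runs P (Seq copy_com (Seq (Query ''ans'' ''H'' (Var ''m'') (Var ''t'') (Var ''k''))
      (Set ''out'' (Plus (Var ''out'') (Var ''ans''))))) m1
    (1 + (bits * ((bits * (1 + 3) + 3) + 3) + 3) + (1 + (1 + bits) + 1)) (\<lambda>qs'. ?R (qs1 @ qs'))"
  proof (rule runs_seq[OF runs_copy_com[OF 1(2,3) X]], elim conjE)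
    fix qs2 :: "club_inst list" and m2 :: memory
    assume 2: "qs2 = []" "ready v r a b m2" "listed ?X m2" "copied (card ?X) 0 m2"
    let ?q = "query_inst m2 ''H'' (Var ''m'') (Var ''t'') (Var ''k'')"
    have q: "?q = (graph_of_matrix (card ?X) (m2 ''H''), t, k)"
      using 2 by (simp add: query_inst_def ready_def prepared_sel listed_card)
    have Pq: "P ?q \<longleftrightarrow> solvable ?X"
      unfolding q
    proof (rule P_query)
      show "inj_on (\<lambda>i. m2 ''L'' i 0) {..<card ?X}" "(\<lambda>i. m2 ''L'' i 0) ` {..<card ?X} = ?X"
        using 2(3) listed_card[OF 2(3)] by (auto simp: listed_def)
      show "m2 ''H'' i j = of_bool (E (m2 ''L'' i 0) (m2 ''L'' j 0))" if "i < card ?X" "j < card ?X" for i j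
        using 2(4) listed_card[OF 2(3)] that by (auto simp: copied_def)
    qed
    \<comment> \<open>A query keeps \<open>t\<close> and \<open>k\<close> and has at most
      \<open>n\<close> vertices, so it costs no more than the size of the input.\<close>
    have size: "inst_size ?q \<le> bits"
      unfolding q using X by (intro inst_size_le[of _ "card ?X"]) (simp_all add: graph_of_matrix_def)
    have query: "runs P (Query ''ans'' ''H'' (Var ''m'') (Var ''t'') (Var ''k'')) m2 (1 + bits)
      (\<lambda>qs m'. qs = [?q] \<and> m' = store m2 ''ans'' 0 0 (of_bool (solvable ?X)))"
      by (rule runs_mono[OF runs_query]) (use size Pq in auto)
    show "runs P (Seq (Query ''ans'' ''H'' (Var ''m'') (Var ''t'') (Var ''k''))
      (Set ''out'' (Plus (Var ''out'') (Var ''ans'')))) m2 (1 + (1 + bits) + 1)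
      (\<lambda>qs'. (\<lambda>qs'. ?R (qs1 @ qs')) (qs2 @ qs'))"
    proof (rule runs_seq[OF query], elim conjE, rule runs_mono[OF runs_assign le_refl], elim conjE)
      fix qs3 qs4 :: "club_inst list" and m3 m4 :: memory
      assume 3: "qs3 = [?q]" "m3 = store m2 ''ans'' 0 0 (of_bool (solvable ?X))"
        "qs4 = []" "m4 = store m3 ''out'' (val m3 (Const 0)) (val m3 (Const 0))
          (val m3 (Plus (Var ''out'') (Var ''ans'')))"
      then have "m4 = store m3 ''out'' 0 0 (r + of_bool (solvable ?X))" "ready v r a b m3"
        using 2 by (simp_all add: ready_def)
      then have "ready v (r + of_bool (solvable ?X)) a b m4"
        by (simp add: ready_def)
      then show "?R (qs1 @ qs2 @ qs3 @ qs4) m4"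
        using 1 2 3 q by (auto simp: graph_of_matrix_def)
    qed
  qed
qed

text \<open>As long as the flag is unset, no far pair occurs lexicographically before (i, j); once
  it is set, \<open>a\<close> and \<open>b\<close> hold such a pair.\<close>

definition searched :: "nat \<Rightarrow> nat \<Rightarrow> nat \<Rightarrow> nat \<Rightarrow> memory \<Rightarrow> bool" where
  "searched v r i j m \<longleftrightarrow> ready v r (m ''a'' 0 0) (m ''b'' 0 0) m \<and>
    (if m ''f'' 0 0 = 0
     then \<forall>x\<in>ball v. \<forall>y\<in>ball v. x < i \<or> x = i \<and> y < j \<longrightarrow> near E {..<n} x y
     else m ''a'' 0 0 \<in> ball v \<and> m ''b'' 0 0 \<in> ball v \<and>
       \<not> near E {..<n} (m ''a'' 0 0) (m ''b'' 0 0))"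

lemma searched_counter [simp]:
  "searched v r i j (store m ''x'' a b c) \<longleftrightarrow> searched v r i j m"
  "searched v r i j (store m ''y'' a b c) \<longleftrightarrow> searched v r i j m"
  by (simp_all add: searched_def)

lemma mem_ball: "x \<in> ball v \<longleftrightarrow> x < n \<and> near E {..<n} v x"
  by (auto simp: ball_def)

lemma runs_search_com:
  assumes ready: "ready v r a b m" and v: "v < n"
  shows "runs P search_com m (2 + (bits * ((bits * ((1 + (2 + (2 + 1))) + 3) + 3) + 3) + 3))
    (\<lambda>qs m'. qs = [] \<and> searched v r n 0 m')"
proof -
  let ?e = "AndE (AndE (Cell ''R'' (Var ''v'') (Var ''x'')) (Cell ''R'' (Var ''v'') (Var ''y'')))
    (NotE (Cell ''R'' (Var ''x'') (Var ''y'')))"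
  let ?t = "Seq (Set ''a'' (Var ''x'')) (Seq (Set ''b'' (Var ''y'')) (Set ''f'' (Const 1)))"
  let ?c = "If ?e ?t Skip"
  show ?thesis
    unfolding search_com_def
  proof (rule runs_assign_seq,
      rule runs_for[where N = n and Inv = "\<lambda>i qs m'. qs = [] \<and> searched v r i 0 m'"])
    fix i and qs :: "club_inst list" and m' :: memory
    assume 1: "i < n" "qs = [] \<and> searched v r i 0 m'" "m' ''x'' 0 0 = i" "m' ''n'' 0 0 = n"
    show "runs P (for_upto ''y'' ''n'' ?c) m' (bits * ((1 + (2 + (2 + 1))) + 3) + 3)
      (\<lambda>qs' m''. m'' ''x'' 0 0 = i \<and> m'' ''n'' 0 0 = n \<and> qs @ qs' = [] \<and>
        searched v r (Suc i) 0 (store m'' ''x'' 0 0 (Suc i)))"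
    proof (rule runs_for[where N = n and Inv = "\<lambda>j qs m'. qs = [] \<and> searched v r i j m' \<and> m' ''x'' 0 0 = i"])
      fix j and qs :: "club_inst list" and m' :: memory
      assume 2: "j < n" "qs = [] \<and> searched v r i j m' \<and> m' ''x'' 0 0 = i" "m' ''y'' 0 0 = j"
        "m' ''n'' 0 0 = n"
      have e: "val m' ?e \<noteq> 0 \<longleftrightarrow> i \<in> ball v \<and> j \<in> ball v \<and> \<not> near E {..<n} i j"
        using 1(1) 2 v by (simp add: searched_def ready_def prepared_sel mem_ball conj_ac)
      let ?R = "\<lambda>qs' m''. m'' ''y'' 0 0 = j \<and> m'' ''n'' 0 0 = n \<and> qs @ qs' = [] \<and>
        searched v r i (Suc j) (store m'' ''y'' 0 0 (Suc j)) \<and>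
        store m'' ''y'' 0 0 (Suc j) ''x'' 0 0 = i"
      show "runs P ?c m' (1 + (2 + (2 + 1))) ?R"
      proof (rule runs_if)
        assume "val m' ?e \<noteq> 0"
        then have bad: "i \<in> ball v" "j \<in> ball v" "\<not> near E {..<n} i j" using e by auto
        let ?m2 = "store (store (store m' ''a'' 0 0 i) ''b'' 0 0 j) ''f'' 0 0 1"
        have "prepared (store (store m' ''a'' 0 0 i) ''b'' 0 0 j)"
          using 2 by (simp add: searched_def ready_def)
        then have "searched v r i (Suc j) ?m2"
          using 2 bad by (simp add: searched_def ready_def)
        then have "?R [] ?m2"
          using 2 by simp
        then show "runs P ?t m' (2 + (2 + 1)) ?R"
          using 2 by (intro runs_assign_seq runs_mono[OF runs_assign le_refl]) simp
      next
        assume "val m' ?e = 0"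
        then have "searched v r i (Suc j) m'"
          using 2 e by (auto simp: searched_def less_Suc_eq)
        then show "runs P Skip m' (2 + (2 + 1)) ?R"
          using 2 by (intro runs_mono[OF runs_skip]) simp_all
      qed
    next
      fix qs' :: "club_inst list" and m' :: memory
      assume 3: "qs' = [] \<and> searched v r i n m' \<and> m' ''x'' 0 0 = i" "m' ''n'' 0 0 = n"
      \<comment> \<open>All vertices of the ball are below \<open>n\<close>, so the finished row
        covers every partner of \<open>i\<close>.\<close>
      from 3(1) have "searched v r (Suc i) 0 m'"
        by (auto simp: searched_def less_Suc_eq mem_ball)
      with 1 3 show "m' ''x'' 0 0 = i \<and> m' ''n'' 0 0 = n \<and> qs @ qs' = [] \<and>
        searched v r (Suc i) 0 (store m' ''x'' 0 0 (Suc i))" by simp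
    qed (use 1 n_le_s in auto)
  qed (use assms n_le_s in \<open>auto simp: searched_def ready_def prepared_sel\<close>)
qed

text \<open>\<open>b\<close> is an acceptable verdict on the solutions containing \<open>v\<close>: it may be true because of others.\<close>
definition vertex_ok :: "nat \<Rightarrow> bool \<Rightarrow> bool" where
  "vertex_ok v b \<longleftrightarrow> (b \<longrightarrow> solvable {..<n}) \<and>
    ((\<exists>S\<subseteq>{..<n}. v \<in> S \<and> club E S \<and> Q t E S \<and> k \<le> card S) \<longrightarrow> b)"

lemma solvable_mono: "solvable X \<Longrightarrow> X \<subseteq> Y \<Longrightarrow> solvable Y"
  unfolding solvable_def by blast

lemma vertex_ok_ball: "vertex_ok v (solvable (ball v))"
  unfolding vertex_ok_def
proof (intro conjI impI)
  show "solvable {..<n}" if "solvable (ball v)"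
    using that ball_subset by (rule solvable_mono)
  show "solvable (ball v)" if "\<exists>S\<subseteq>{..<n}. v \<in> S \<and> club E S \<and> Q t E S \<and> k \<le> card S"
    using that club_subset_ball unfolding solvable_def by blast
qed

lemma vertex_ok_remove:
  assumes "\<not> near E {..<n} a b"
  shows "vertex_ok v (solvable (ball v - {a}) \<or> solvable (ball v - {b}))"
  unfolding vertex_ok_def
proof (intro conjI impI)
  show "solvable {..<n}" if "solvable (ball v - {a}) \<or> solvable (ball v - {b})"
    using that solvable_mono ball_subset by (meson Diff_subset order_trans)
  assume "\<exists>S\<subseteq>{..<n}. v \<in> S \<and> club E S \<and> Q t E S \<and> k \<le> card S"
  then obtain S where S: "S \<subseteq> {..<n}" "v \<in> S" "club E S" "Q t E S" "k \<le> card S" by blast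
  have "S \<subseteq> ball v" using S club_subset_ball by blast
  moreover have "\<not> (a \<in> S \<and> b \<in> S)"
    using S(1,3) assms unfolding club_def near_def by blast
  ultimately show "solvable (ball v - {a}) \<or> solvable (ball v - {b})"
    unfolding solvable_def using S by blast
qed

lemma vertex_ok_moore:
  assumes "v < n" "D\<^sup>2 < card (ball v)" "\<And>x y. x \<in> ball v \<Longrightarrow> y \<in> ball v \<Longrightarrow> near E {..<n} x y"
  shows "vertex_ok v (moore D t k)"
proof -
  \<comment> \<open>More than D^2 but at most D^2 + 1 vertices: the ball meets the Moore
    bound.\<close>
  interpret moore_ball "{..<n}" E D v
    using assms card_ball_le[of v] by unfold_locales auto
  have moore: "moore_ball {..<n} E D v" by (rule moore_ball_axioms)
  show ?thesis
    unfolding vertex_ok_def solvable_def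
    using moore_sound[OF moore] moore_complete[OF moore] club_subset_ball by blast
qed

lemma ball_count: "v < n \<Longrightarrow> (\<Sum>u<n. of_bool (near E {..<n} v u)) = card (ball v)"
  by (simp add: ball_def Int_def conj_commute)

section \<open>The verdict for one vertex and the whole program\<close>

abbreviation vertex_time :: nat where
  "vertex_time \<equiv> 1 + (bits * 4 + 5) + (1 + (1 +
    (2 + (bits * ((bits * ((1 + (2 + (2 + 1))) + 3) + 3) + 3) + 3)) + (1 + (1 + ask_time + ask_time))))"

text \<open>\<open>c\<close> is what the round for \<open>v\<close> adds to \<open>out\<close>. The
  final \<open>a\<close> and \<open>b\<close> are left open because the round overwrites
  them.\<close>

lemma runs_vertex_com:
  assumes ready: "ready v r a b m" and v: "v < n"
  shows "runs P (vertex_com moore_exp) m vertex_time (\<lambda>qs m'. \<exists>c a b. length qs \<le> 2 \<and>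
    (\<forall>(H, t', k') \<in> set qs. card (pverts H) \<le> D\<^sup>2) \<and> vertex_ok v (c \<noteq> 0) \<and> ready v (r + c) a b m')"
  (is "runs P _ m _ ?R")
  unfolding vertex_com_def
proof (rule runs_seq[OF runs_accumulate[where N = n and g = "\<lambda>u. of_bool (near E {..<n} v u)"]])
  fix qs1 :: "club_inst list" and m1 :: memory
  assume "qs1 = [] \<and> m1 = store (store m ''u'' 0 0 n) ''d'' 0 0 (\<Sum>u<n. of_bool (near E {..<n} v u))"
  then have 1: "qs1 = []" "ready v r a b m1" "m1 ''d'' 0 0 = card (ball v)"
    using ready by (simp_all add: ball_count[OF v] del: sum_of_bool_eq)
  let ?big = "Seq search_com (If (Var ''f'') (Seq (ask_com ''a'') (ask_com ''b''))
    (Set ''out'' (Plus (Var ''out'') moore_exp)))"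
  let ?T = "1 + (2 + (bits * ((bits * ((1 + (2 + (2 + 1))) + 3) + 3) + 3) + 3)) + (1 + (1 + ask_time + ask_time))"
  show "runs P (If (LeE (Var ''d'') (Var ''S'')) (Seq (Set ''a'' (Var ''n'')) (ask_com ''a'')) ?big)
    m1 (1 + ?T) (\<lambda>qs'. ?R (qs1 @ qs'))"
  proof (rule runs_if)
    assume "val m1 (LeE (Var ''d'') (Var ''S'')) \<noteq> 0"
    then have small: "card (ball v) \<le> D\<^sup>2"
      using 1 by (simp add: ready_def prepared_sel split: if_splits)
    let ?m2 = "store m1 ''a'' 0 0 n"
    have 2: "ready v r n b ?m2"
      using 1(2) by (simp add: ready_def)
    have n: "ball v - {n} = ball v" using ball_subset by blast
    have ask: "runs P (ask_com ''a'') ?m2 ask_time (?R \<circ> (@) qs1)"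
      using runs_ask_com[OF 2 v, of "''a''" n]
    proof (rule runs_mono)
      fix qs :: "club_inst list" and m' :: memory
      assume "\<exists>H. qs = [(H, t, k)] \<and> card (pverts H) = card (ball v - {n}) \<and>
        ready v (r + of_bool (solvable (ball v - {n}))) n b m'"
      then show "(?R \<circ> (@) qs1) qs m'"
        using small vertex_ok_ball[of v] 1(1) unfolding n comp_def
        by (intro exI[of _ "of_bool (solvable (ball v))"] exI[of _ n] exI[of _ b]) auto
    qed simp_all
    have "m1 ''n'' 0 0 = n" using 1(2) by (simp add: ready_def prepared_sel)
    then have "runs P (Seq (Set ''a'' (Var ''n'')) (ask_com ''a'')) m1 (2 + ask_time) (?R \<circ> (@) qs1)"
      using ask by (intro runs_assign_seq) simp
    then show "runs P (Seq (Set ''a'' (Var ''n'')) (ask_com ''a'')) m1 ?T (\<lambda>qs'. ?R (qs1 @ qs'))"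
      by (rule runs_mono) auto
  next
    assume "val m1 (LeE (Var ''d'') (Var ''S'')) = 0"
    then have large: "D\<^sup>2 < card (ball v)"
      using 1 by (simp add: ready_def prepared_sel split: if_splits)
    \<comment> \<open>Removing any one vertex brings the ball from at most D^2 + 1 vertices down to
      the permitted size.\<close>
    then have rm: "card (ball v - {c}) \<le> D\<^sup>2" if "c \<in> ball v" for c
      using that card_ball_le[of v] v finite_ball by simp
    show "runs P ?big m1 ?T (\<lambda>qs'. ?R (qs1 @ qs'))"
    proof (rule runs_seq[OF runs_search_com[OF 1(2) v]], elim conjE)
      fix qs2 :: "club_inst list" and m2 :: memory
      assume 2: "qs2 = []" "searched v r n 0 m2"
      let ?a = "m2 ''a'' 0 0" and ?b = "m2 ''b'' 0 0"
      have r2: "ready v r ?a ?b m2" using 2 by (simp add: searched_def)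
      show "runs P (If (Var ''f'') (Seq (ask_com ''a'') (ask_com ''b''))
          (Set ''out'' (Plus (Var ''out'') moore_exp))) m2 (1 + (1 + ask_time + ask_time))
        (\<lambda>qs'. (\<lambda>qs'. ?R (qs1 @ qs')) (qs2 @ qs'))"
      proof (rule runs_if)
        assume "val m2 (Var ''f'') \<noteq> 0"
        then have bad: "?a \<in> ball v" "?b \<in> ball v" "\<not> near E {..<n} ?a ?b"
          using 2 by (auto simp: searched_def)
        let ?A = "solvable (ball v - {?a})" and ?B = "solvable (ball v - {?b})"
        show "runs P (Seq (ask_com ''a'') (ask_com ''b'')) m2 (1 + ask_time + ask_time)
          (\<lambda>qs'. (\<lambda>qs'. ?R (qs1 @ qs')) (qs2 @ qs'))"
        proof (rule runs_seq[OF runs_ask_com[OF r2 v, of "''a''" ?a]])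
          fix qs3 :: "club_inst list" and m3 :: memory
          assume "\<exists>H. qs3 = [(H, t, k)] \<and> card (pverts H) = card (ball v - {?a}) \<and>
            ready v (r + of_bool ?A) ?a ?b m3"
          then obtain H where 3: "qs3 = [(H, t, k)]" "card (pverts H) = card (ball v - {?a})"
              "ready v (r + of_bool ?A) ?a ?b m3" by blast
          show "runs P (ask_com ''b'') m3 ask_time
            (\<lambda>qs'. (\<lambda>qs'. (\<lambda>qs'. ?R (qs1 @ qs')) (qs2 @ qs')) (qs3 @ qs'))"
          proof (rule runs_mono[OF runs_ask_com[OF 3(3) v, of "''b''" ?b] le_refl])
            fix qs4 :: "club_inst list" and m4 :: memory
            assume "\<exists>H. qs4 = [(H, t, k)] \<and> card (pverts H) = card (ball v - {?b}) \<and>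
              ready v (r + of_bool ?A + of_bool ?B) ?a ?b m4"
            then obtain H' where 4: "qs4 = [(H', t, k)]" "card (pverts H') = card (ball v - {?b})"
                "ready v (r + of_bool ?A + of_bool ?B) ?a ?b m4" by blast
            have "(of_bool ?A + of_bool ?B \<noteq> (0::nat)) = (?A \<or> ?B)" by simp
            then have "vertex_ok v (of_bool ?A + of_bool ?B \<noteq> (0::nat))"
              using vertex_ok_remove[OF bad(3), of v] by (simp only:)
            then show "?R (qs1 @ qs2 @ qs3 @ qs4) m4"
              using 1(1) 2(1) 3 4 rm bad
              by (intro exI[of _ "of_bool ?A + of_bool ?B"] exI[of _ ?a] exI[of _ ?b]) (auto simp: add.assoc)
          qed (use 3 in \<open>auto simp: ready_def\<close>)
        qed auto
      next
        assume "val m2 (Var ''f'') = 0"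
        then have "near E {..<n} x y" if "x \<in> ball v" "y \<in> ball v" for x y
          using 2 that by (auto simp: searched_def mem_ball)
        then have ok: "vertex_ok v (moore D t k)"
          using v large by (intro vertex_ok_moore) auto
        have "(val m2 moore_exp \<noteq> 0) = moore D t k"
          using val_moore_exp[of m2] r2 by (simp add: ready_def prepared_sel)
        with ok have ok': "vertex_ok v (val m2 moore_exp \<noteq> 0)" by simp
        let ?m3 = "store m2 ''out'' 0 0 (r + val m2 moore_exp)"
        have "ready v (r + val m2 moore_exp) ?a ?b ?m3"
          using r2 by (simp add: ready_def)
        then have "?R (qs1 @ qs2 @ []) ?m3"
          using ok' 1(1) 2(1) by auto
        then show "runs P (Set ''out'' (Plus (Var ''out'') moore_exp)) m2 (1 + ask_time + ask_time)
          (\<lambda>qs'. (\<lambda>qs'. ?R (qs1 @ qs')) (qs2 @ qs'))"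
          using r2 by (intro runs_mono[OF runs_assign]) (auto simp: ready_def)
      qed
    qed
  qed
qed (use assms n_le_s in \<open>auto simp: ready_def prepared_sel\<close>)

abbreviation main_time :: nat where
  "main_time \<equiv> 1 + (2 + (bits * ((1 + (bits * 4 + 5) + 1) + 3) + 3)) + (1 + (bits * 4 + 5) +
    (1 + (bits * ((bits * ((1 + (bits * 4 + 5) + 1) + 3) + 3) + 3) + 3) +
    (2 + (bits * (vertex_time + 3) + 3))))"

lemma runs_main_com:
  "runs P (main_com trivial_exp moore_exp) (input_memory (G, t, k)) main_time (\<lambda>qs m.
    length qs \<le> 2 * n \<and> (\<forall>(H, t', k') \<in> set qs. card (pverts H) \<le> D\<^sup>2) \<and>
    (accepting m \<longleftrightarrow> P (G, t, k)))"
  (is "runs P _ _ _ ?R")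
  unfolding main_com_def
proof (rule runs_seq[OF runs_degree_com[OF input_memory]], elim conjE)
  \<comment> \<open>The accumulated verdict \<open>r\<close> is sound for the whole graph, and
    complete for trivial solutions and for those containing a vertex already processed.\<close>
  let ?J = "\<lambda>i r. (r \<noteq> 0 \<longrightarrow> solvable {..<n}) \<and> (trivial n t k \<longrightarrow> r \<noteq> 0) \<and>
    (\<forall>v<i. (\<exists>S\<subseteq>{..<n}. v \<in> S \<and> club E S \<and> Q t E S \<and> k \<le> card S) \<longrightarrow> r \<noteq> 0)"
  let ?I = "\<lambda>i qs m. length qs \<le> 2 * i \<and> (\<forall>(H, t', k') \<in> set qs. card (pverts H) \<le> D\<^sup>2) \<and>
    ready i (m ''out'' 0 0) (m ''a'' 0 0) (m ''b'' 0 0) m \<and> ?J i (m ''out'' 0 0)"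
  fix qs1 :: "club_inst list" and m1 :: memory
  assume 1: "qs1 = []" "input m1" "m1 ''D'' 0 0 = D"
  let ?c4 = "Seq (Set ''out'' trivial_exp) (for_upto ''v'' ''n'' (vertex_com moore_exp))"
  show "runs P (Seq (accumulate ''S'' ''i'' ''D'' (Var ''D'')) (Seq near_com ?c4)) m1
    (1 + (bits * 4 + 5) + (1 + (bits * ((bits * ((1 + (bits * 4 + 5) + 1) + 3) + 3) + 3) + 3) +
    (2 + (bits * (vertex_time + 3) + 3)))) (\<lambda>qs'. ?R (qs1 @ qs'))"
  proof (rule runs_seq[OF runs_accumulate[where N = D and g = "\<lambda>_. D"]])
    fix qs2 :: "club_inst list" and m2 :: memory
    assume "qs2 = [] \<and> m2 = store (store m1 ''i'' 0 0 D) ''S'' 0 0 (\<Sum>i<D. D)"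
    then have 2: "qs2 = []" "input m2" "m2 ''D'' 0 0 = D" "m2 ''S'' 0 0 = D\<^sup>2"
      using 1 by (simp_all add: power2_eq_square)
    show "runs P (Seq near_com ?c4) m2 (1 + (bits * ((bits * ((1 + (bits * 4 + 5) + 1) + 3) + 3) + 3) + 3) +
      (2 + (bits * (vertex_time + 3) + 3))) (\<lambda>qs'. (\<lambda>qs'. ?R (qs1 @ qs')) (qs2 @ qs'))"
    proof (rule runs_seq[OF runs_near_com[OF 2(2-4)]], elim conjE)
      fix qs3 :: "club_inst list" and m3 :: memory
      assume 3: "qs3 = []" "prepared m3"
      let ?m4 = "store m3 ''out'' 0 0 (val m3 trivial_exp)"
      have triv: "val m3 trivial_exp \<noteq> 0 \<longleftrightarrow> trivial n t k"
        using val_trivial_exp[of m3] 3 by (simp add: prepared_sel)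
      have 4: "prepared ?m4" using 3 by simp
      have "runs P (for_upto ''v'' ''n'' (vertex_com moore_exp)) ?m4 (bits * (vertex_time + 3) + 3) ?R"
      proof (rule runs_for[where N = n and Inv = ?I])
        show "?I 0 [] (store ?m4 ''v'' 0 0 0)"
          using 4 triv trivial_sound[of n t k E] by (auto simp: ready_def solvable_def)
      next
        fix i and qs :: "club_inst list" and m' :: memory
        assume 5: "i < n" "?I i qs m'" "m' ''v'' 0 0 = i" "m' ''n'' 0 0 = n"
        let ?r = "m' ''out'' 0 0"
        show "runs P (vertex_com moore_exp) m' vertex_time
          (\<lambda>qs' m''. m'' ''v'' 0 0 = i \<and> m'' ''n'' 0 0 = n \<and> ?I (Suc i) (qs @ qs') (store m'' ''v'' 0 0 (Suc i)))"
        proof (rule runs_mono[OF runs_vertex_com[OF _ 5(1)] le_refl])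
          show "ready i ?r (m' ''a'' 0 0) (m' ''b'' 0 0) m'" using 5 by blast
        next
          fix qs' :: "club_inst list" and m'' :: memory
          assume "\<exists>c a b. length qs' \<le> 2 \<and> (\<forall>(H, t', k') \<in> set qs'. card (pverts H) \<le> D\<^sup>2) \<and>
            vertex_ok i (c \<noteq> 0) \<and> ready i (?r + c) a b m''"
          then obtain c a b where 6: "length qs' \<le> 2"
              "\<forall>(H, t', k') \<in> set qs'. card (pverts H) \<le> D\<^sup>2"
              "vertex_ok i (c \<noteq> 0)" "ready i (?r + c) a b m''" by blast
          have J: "?J (Suc i) (?r + c)"
            using 5(2) 6(3) by (auto simp: vertex_ok_def less_Suc_eq)
          have len: "length (qs @ qs') \<le> 2 * Suc i" using 5(2) 6(1) by simp
          have set: "\<forall>(H, t', k') \<in> set (qs @ qs'). card (pverts H) \<le> D\<^sup>2"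
            using 5(2) 6(2) by auto
          have r: "m'' ''v'' 0 0 = i" "m'' ''n'' 0 0 = n" "m'' ''out'' 0 0 = ?r + c"
              "prepared m''"
            using 6(4) by (simp_all add: ready_def prepared_sel)
          have "prepared (store m'' ''v'' 0 0 (Suc i))" using r by simp
          then have "ready (Suc i) (?r + c) (store m'' ''v'' 0 0 (Suc i) ''a'' 0 0)
              (store m'' ''v'' 0 0 (Suc i) ''b'' 0 0) (store m'' ''v'' 0 0 (Suc i))"
            using r by (simp add: ready_def)
          moreover have "store m'' ''v'' 0 0 (Suc i) ''out'' 0 0 = ?r + c" using r by simp
          ultimately show "m'' ''v'' 0 0 = i \<and> m'' ''n'' 0 0 = n \<and>
              ?I (Suc i) (qs @ qs') (store m'' ''v'' 0 0 (Suc i))"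
            using J len set r(1,2) by (simp only: simp_thms)
        qed
      next
        fix qs :: "club_inst list" and m' :: memory
        assume 5: "?I n qs m'"
        have "m' ''out'' 0 0 \<noteq> 0" if "solvable {..<n}"
        proof -
          obtain S where S: "S \<subseteq> {..<n}" "Q t E S" "k \<le> card S"
            using \<open>solvable {..<n}\<close> unfolding solvable_def by blast
          \<comment> \<open>A solution is either covered by the initial value of \<open>out\<close>
            or a 2-club with some vertex, and by now every vertex has been processed.\<close>
          from club_or_trivial[OF S] show ?thesis
          proof
            assume "S \<noteq> {} \<and> club E S"
            then obtain v where "v \<in> S" "club E S" by blast
            then show ?thesis using S 5 by blast
          qed (use 5 in blast)
        qed
        then have "accepting m' \<longleftrightarrow> solvable {..<n}"
          using 5 unfolding accepting_def by blast
        also have "\<dots> \<longleftrightarrow> P (G, t, k)"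
          using P_iff[OF pair_graph] verts by (simp add: solvable_def)
        finally show "?R qs m'" using 5 by blast
      qed (use 4 n_le_s in \<open>auto simp: prepared_sel\<close>)
      then show "runs P ?c4 m3 (2 + (bits * (vertex_time + 3) + 3))
        (\<lambda>qs'. (\<lambda>qs'. (\<lambda>qs'. ?R (qs1 @ qs')) (qs2 @ qs')) (qs3 @ qs'))"
        unfolding 1(1) 2(1) 3(1) by (intro runs_assign_seq) simp
    qed
  qed (use 1 D_le n_le_s in auto)
qed

end

section \<open>The three problems\<close>

text \<open>The empty set solves k = 0 and, for t = 0, all vertices together are a solution; for
  larger \<open>t\<close> a short path joins any two vertices, so solutions are 2-clubs. In a Moore
  graph a singleton is robust for every \<open>t\<close>, and the whole graph for t at most
  1.\<close>

lemma club_problem_robust: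
  "club_problem robust_problem robust
    (\<lambda>n t k. k = 0 \<or> t = 0 \<and> k \<le> n) (\<lambda>D t k. k \<le> 1 \<or> t \<le> 1 \<and> k \<le> D\<^sup>2 + 1)
    (Plus (NotE (Var ''k'')) (AndE (NotE (Var ''t'')) (LeE (Var ''k'') (Var ''n''))))
    (Plus (LeE (Var ''k'') (Const 1))
      (AndE (LeE (Var ''t'') (Const 1)) (LeE (Var ''k'') (Plus (Var ''S'') (Const 1)))))"
proof (unfold_locales, goal_cases)
  case (1 G t k)
  then show ?case by (auto simp: robust_problem_def robust_two_club_iff)
next
  case 2
  then show ?case by (intro robust_image) auto
next
  case (3 n t k E)
  then consider "k = 0" | "t = 0" "k \<le> n" by blast
  then show ?case
  proof cases
    case 1
    then show ?thesis by (intro exI[of _ "{}"]) (simp add: robust_def)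
  next
    case 2
    then show ?thesis by (intro exI[of _ "{..<n}"]) (simp add: robust_def)
  qed
next
  case (4 S n t E k)
  then have fin: "finite S" and card: "card S \<le> n"
    using card_mono[of "{..<n}" S] by (auto intro: finite_subset)
  have "club E S" if "t \<noteq> 0"
    unfolding club_def
  proof (intro ballI)
    fix u v assume "u \<in> S" "v \<in> S"
    then have "u = v \<or> 0 < short_paths E S u v"
      using 4(2) that by (fastforce simp: robust_def)
    then show "near E S u v" by (auto simp: near_def short_paths_def card_gt_0_iff)
  qed
  then show ?case using 4 card by (cases "S = {}") auto
next
  case (5 V E D c t k)
  then interpret moore_ball V E D c by simp
  show ?case
  proof (cases "k \<le> 1")
    case True
    then show ?thesis using c_in_V by (intro exI[of _ "{c}"]) (simp add: robust_def)
  next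
    case False
    then have "t \<le> 1" "k \<le> card N" using 5(2) card_N by simp_all
    moreover have "robust t E N"
      using robust_N \<open>t \<le> 1\<close> unfolding robust_def by (meson order_trans)
    ultimately show ?thesis using ball_subset by blast
  qed
next
  case (6 V E D c S t k)
  then interpret moore_ball V E D c by simp
  have "card S \<le> card N" using 6 finite_ball by (simp add: card_mono)
  then show ?case using 6 robust_moore[of t S] card_N by (cases "2 \<le> t") auto
qed auto

text \<open>Taking U = {} shows that nonempty solutions are 2-clubs. In a Moore graph singletons and
  edges are hereditary for every \<open>t\<close>, while for t = 0 the whole graph is a
  solution.\<close>

lemma club_problem_hereditary:
  "club_problem hereditary_problem hereditary
    (\<lambda>n t k. k = 0) (\<lambda>D t k. k \<le> 1 \<or> k \<le> 2 \<and> 1 \<le> D \<or> t = 0 \<and> k \<le> D\<^sup>2 + 1)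
    (NotE (Var ''k''))
    (Plus (LeE (Var ''k'') (Const 1))
      (Plus (AndE (LeE (Var ''k'') (Const 2)) (LeE (Const 1) (Var ''D'')))
        (AndE (NotE (Var ''t'')) (LeE (Var ''k'') (Plus (Var ''S'') (Const 1))))))"
proof (unfold_locales, goal_cases)
  case (1 G t k)
  then show ?case by (auto simp: hereditary_problem_def hereditary_two_club_iff)
next
  case 2
  then show ?case by (intro hereditary_image) auto
next
  case 3
  then show ?case by (intro exI[of _ "{}"]) (simp add: hereditary_def)
next
  case (4 S n t E k)
  have "club E (S - {})" if "S \<noteq> {}"
    using 4(2) that unfolding hereditary_def by (metis bot.not_eq_extremum card.empty le0)
  then show ?case using 4 by (cases "S = {}") auto
next
  case (5 V E D c t k)
  then interpret moore_ball V E D c by simp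
  consider "k \<le> 1" | "k \<le> 2" "1 \<le> D" | "t = 0" "k \<le> D\<^sup>2 + 1" using 5(2) by blast
  then show ?case
  proof cases
    case 1
    have "hereditary t E {c}" by (auto simp: hereditary_def club_def near_def)
    then show ?thesis using 1 c_in_V by (intro exI[of _ "{c}"]) simp
  next
    case 2
    then have "card {u. E c u} > 0" using degree_eq[OF c_in_N] by simp
    then obtain u where u: "E c u" by (auto simp: card_gt_0_iff)
    then have "card {c, u} = 2" "{c, u} \<subseteq> V" using edge_irrefl edge_in_V by (auto simp: card_insert_if)
    moreover have "hereditary t E {c, u}"
      using u edge_sym[OF u] by (auto simp: hereditary_def club_def near_def)
    ultimately show ?thesis using 2 by (intro exI[of _ "{c, u}"]) simp
  next
    case 3
    have "U = {}" if "U \<subset> N" "card U \<le> 0" for U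
      using that finite_ball by (metis card_0_eq finite_subset le_zero_eq psubset_imp_subset)
    then have "hereditary t E N"
      using 3(1) club_N unfolding hereditary_def by (metis Diff_empty)
    then show ?thesis using 3 card_N ball_subset by (intro exI[of _ N]) simp
  qed
next
  case (6 V E D c S t k)
  then interpret moore_ball V E D c by simp
  have card: "card S \<le> card N" using 6 finite_ball by (simp add: card_mono)
  \<comment> \<open>Without edges the ball is a single vertex, which is why size 2 is only granted
    for D at least 1.\<close>
  then have "D = 0 \<Longrightarrow> card S \<le> 1" using card_N by simp
  then show ?case using 6 card card_N hereditary_moore[of t S] by (cases "t = 0") fastforce+
qed auto

text \<open>A solution is a 2-club with more than \<open>t\<close> vertices, hence nonempty, so
  nothing is trivial. In a Moore graph the entire graph is an optimal solution as soon as t is at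
  most D.\<close>

lemma club_problem_connected:
  "club_problem connected_problem conn
    (\<lambda>n t k. False) (\<lambda>D t k. t \<le> D \<and> k \<le> D\<^sup>2 + 1)
    (Const 0) (AndE (LeE (Var ''t'') (Var ''D'')) (LeE (Var ''k'') (Plus (Var ''S'') (Const 1))))"
proof (unfold_locales, goal_cases)
  case (1 G t k)
  then show ?case by (auto simp: connected_problem_def connected_two_club_iff)
next
  case 2
  then show ?case by (intro conn_image) auto
next
  case (5 V E D c t k)
  then interpret moore_ball V E D c by simp
  show ?case using 5(2) conn_N[of t] card_N ball_subset by (intro exI[of _ N]) simp
next
  case (6 V E D c S t k)
  then interpret moore_ball V E D c by simp
  have "card S \<le> card N" using 6 finite_ball by (simp add: card_mono)
  moreover have "t \<le> D" using 6 ball_subset by (intro conn_le_degree[of t S]) auto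
  ultimately show ?case using 6 card_N by simp
qed (auto simp: conn_def)

text \<open>A transcript of \<open>main_time\<close> with the indeterminate in place of
  \<open>bits\<close>, kept unexpanded so that evaluation gives that bound literally. It is cubic in
  the size of the instance.\<close>

definition time_poly :: "nat poly" where
  "time_poly = (let s = [:0, 1:];
     ask = 1 + (2 + (s * ((2 + 1) + 3) + 3)) + (1 + (s * ((s * (1 + 3) + 3) + 3) + 3) + (1 + (1 + s) + 1));
     vertex = 1 + (s * 4 + 5) + (1 + (1 +
       (2 + (s * ((s * ((1 + (2 + (2 + 1))) + 3) + 3) + 3) + 3)) + (1 + (1 + ask + ask))))
   in 1 + (2 + (s * ((1 + (s * 4 + 5) + 1) + 3) + 3)) + (1 + (s * 4 + 5) +
     (1 + (s * ((s * ((1 + (s * 4 + 5) + 1) + 3) + 3) + 3) + 3) + (2 + (s * (vertex + 3) + 3)))))"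

lemma (in club_instance) poly_time_poly: "poly time_poly bits = main_time"
  by (simp only: time_poly_def Let_def poly_add poly_mult poly_1 poly_numeral poly_pCons poly_0
      mult_zero_right add_0_right add_0_left mult_1_right)

lemma (in club_problem) turing_kernel:
  "\<exists>(c :: com) (q :: nat \<Rightarrow> nat) (p :: nat poly).
    (\<lambda>n. real (q n)) \<in> O(\<lambda>n. real n) \<and>
    (\<forall>(n :: nat) (G :: nat pair_pre_digraph) (t :: nat) (k :: nat).
      pair_graph G \<and> pverts G = {..<n} \<longrightarrow>
      (\<exists>T qs m.
        exec P c (input_memory (G, t, k)) T qs m \<and>
        (accepting m \<longleftrightarrow> P (G, t, k)) \<and>
        T \<le> poly p (inst_size (G, t, k)) \<and>
        length qs \<le> q n \<and>
        (\<forall>(H, t', k') \<in> set qs. card (pverts H) \<le> max_degree G ^ 2)))"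
\<comment> \<open>The witness 2 n allows for the queries without \<open>a\<close> and without
  \<open>b\<close> at every vertex.\<close>
proof (rule exI[of _ "main_com trivial_exp moore_exp"], rule exI[of _ "\<lambda>n. 2 * n"],
    rule exI[of _ time_poly], intro conjI allI impI)
  show "(\<lambda>n. real (2 * n)) \<in> O(\<lambda>n. real n)" by simp
next
  fix n :: nat and G :: "nat pair_pre_digraph" and t k :: nat
  assume "pair_graph G \<and> pverts G = {..<n}"
  then interpret club_instance P Q trivial moore trivial_exp moore_exp G n t k
    by (intro club_instance.intro club_problem_axioms club_instance_axioms.intro; elim conjE)
  have "poly time_poly (inst_size (G, t, k)) = main_time"
    using poly_time_poly by (simp only: bits_def)
  then show "\<exists>T qs m. exec P (main_com trivial_exp moore_exp) (input_memory (G, t, k)) T qs m \<and>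
        (accepting m \<longleftrightarrow> P (G, t, k)) \<and> T \<le> poly time_poly (inst_size (G, t, k)) \<and>
        length qs \<le> 2 * n \<and> (\<forall>(H, t', k') \<in> set qs. card (pverts H) \<le> max_degree G ^ 2)"
    using runs_main_com unfolding runs_def by metis
qed

theorem theorem5:
  fixes P :: "club_inst \<Rightarrow> bool"
  assumes "P \<in> {robust_problem, hereditary_problem, connected_problem}"
  shows "\<exists>(c :: com) (q :: nat \<Rightarrow> nat) (p :: nat poly).
    (\<lambda>n. real (q n)) \<in> O(\<lambda>n. real n) \<and>
    (\<forall>(n :: nat) (G :: nat pair_pre_digraph) (t :: nat) (k :: nat).
      pair_graph G \<and> pverts G = {..<n} \<longrightarrow>
      (\<exists>T qs m.
        exec P c (input_memory (G, t, k)) T qs m \<and>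
        (accepting m \<longleftrightarrow> P (G, t, k)) \<and>
        T \<le> poly p (inst_size (G, t, k)) \<and>
        length qs \<le> q n \<and>
        (\<forall>(H, t', k') \<in> set qs. card (pverts H) \<le> max_degree G ^ 2)))"
  using assms club_problem.turing_kernel[OF club_problem_robust]
    club_problem.turing_kernel[OF club_problem_hereditary]
    club_problem.turing_kernel[OF club_problem_connected]
  by blast

end
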